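(* Let $p\ge q\ge 0$ be integers with $p+q\ge 1$, and let $S_1,\dots,S_{p+q}$ be the basis matrices of an $m$-dimensional representation $\rho$ of $R_{p,q}=C_p\otimes C_q$ on $W=\mathbb{R}^m$. Let $Q(w)=(S_1[w],\dots,S_{p+q}[w])$ and $\tilde P(w)=\sum_{i=1}^pS_i[w]^2-\sum_{i=p+1}^{p+q}S_i[w]^2$. The following four conditions are equivalent: (i) the quadratic mapping $Q$ is degenerate; (ii) the Clifford quartic form $\tilde P(w)$ vanishes identically; (iii) there exist linear forms $f_1(w),\dots,f_{p+q}(w)$ on $W$, not all of which are $0$, satisfying the identity $\sum_{i=1}^{p+q}S_i[w]f_i(w)\equiv 0$; (iv) $(p,q,m)$ is one of $(2,1,2),(3,1,4),(5,1,8),(9,1,16),(2,2,4),(3,3,8),(5,5,16)$, or $(p,q)=(1,1)$ and $S_1=\pm S_2$.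
   Context: $C_r$ denotes the real Clifford algebra of the positive definite quadratic form in $r$ variables (generators $e_1,\dots,e_r$, $e_i^2=1$, $e_ie_j=-e_je_i$ for $i\ne j$; $C_0=\mathbb{R}$). $R_{p,q}=C_p\otimes_{\mathbb{R}}C_q$ (ordinary, ungraded tensor product) with $e_1,\dots,e_p$ the generators of $C_p$ and $e_{p+1},\dots,e_{p+q}$ those of $C_q$. Representations $\rho:R_{p,q}\to M(m;\mathbb{R})$ are unital, with $m\ge1$, and (after replacing by an equivalent one) are always taken so that the matrices $S_i=\rho(e_i)$ are symmetric; $S_1,\dots,S_{p+q}$ are called the basis matrices of $\rho$. Thus $S_i^2=1_m$, $S_iS_j=-S_jS_i$ if $i\neq j$ are both $\le p$ or both $>p$, and $S_iS_j=S_jS_i$ if exactly one of $i,j$ is $\le p$. For a symmetric matrix $S$, $S[w]={}^tw\,S\,w$. $P(v)=\sum_{i\le p}v_i^2-\sum_{i>p}v_i^2$, so $\tilde P=P\circ Q$; $\tilde P$ is called the Clifford quartic form associated with $\rho$. $Q$ is called non-degenerate if, regarding it as a polynomial map $\mathbb{C}^m\to\mathbb{C}^{p+q}$, the open set $\{w\in\mathbb{C}^m:P(Q(w))\neq0\}$ is non-empty and the differential of $Q$ has rank $p+q$ at every point of this set; otherwise $Q$ is degenerate. *)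

theory Defs
  imports
    "HOL-Analysis.Analysis"
    "HOL-Algebra.Module"
    "HOL-Library.Function_Algebras"
begin

section \<open>The Clifford algebra and the tensor product\<close>

definition unit_fun :: "'i \<Rightarrow> 'i \<Rightarrow> real" where
  "unit_fun a = (\<lambda>b. if b = a then 1 else 0)"

text \<open>
  The Clifford algebra of the positive definite form in \<open>r\<close> variables has the basis
  \<open>e\<^sub>A = e\<^sub>a\<^sub>1 \<dots> e\<^sub>a\<^sub>k\<close>, where \<open>A = {a1 < \<dots> < ak}\<close> runs over the subsets of \<open>{1..r}\<close>.
  Sorting the product \<open>e\<^sub>A e\<^sub>B\<close> takes one sign for each pair \<open>b < a\<close>, and
  common generators cancel because \<open>e\<^sub>i\<^sup>2 = 1\<close>; hence \<open>e\<^sub>A e\<^sub>B = \<plusminus> e\<^sub>C\<close> with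
  \<open>C\<close> the symmetric difference. An element is represented by its coordinate function
  with respect to this basis.
\<close>

definition blade_sign :: "nat set \<Rightarrow> nat set \<Rightarrow> real" where
  "blade_sign A B = (- 1) ^ card {(a, b). a \<in> A \<and> b \<in> B \<and> b < a}"

definition clifford_algebra :: "nat \<Rightarrow> (real, nat set \<Rightarrow> real) module" where
  "clifford_algebra r =
    \<lparr> carrier = {x. \<forall>A. x A \<noteq> 0 \<longrightarrow> A \<subseteq> {1..r}},
      monoid.mult = (\<lambda>x y C. \<Sum>A\<in>Pow {1..r}. \<Sum>B\<in>Pow {1..r}.
        x A * y B * blade_sign A B * unit_fun ((A - B) \<union> (B - A)) C),
      one = unit_fun {},
      zero = (\<lambda>A. 0),
      add = (\<lambda>x y A. x A + y A),
      smult = (\<lambda>c x A. c * x A) \<rparr>"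

definition clifford_gen :: "nat \<Rightarrow> nat set \<Rightarrow> real" where
  "clifford_gen i = unit_fun {i}"

lemma sum_unit_fun:
  assumes "finite I" "a \<in> I"
  shows "(\<Sum>x\<in>I. unit_fun a x * f x) = f a"
proof -
  have "(\<Sum>x\<in>I. unit_fun a x * f x) = (\<Sum>x\<in>I. if x = a then f x else 0)"
    by (rule sum.cong) (auto simp: unit_fun_def)
  then show ?thesis using assms by (simp add: sum.delta)
qed

lemma clifford_mult_unit_fun:
  assumes "A \<subseteq> {1..r}" "B \<subseteq> {1..r}"
  shows "unit_fun A \<otimes>\<^bsub>clifford_algebra r\<^esub> unit_fun B =
    (\<lambda>C. blade_sign A B * unit_fun ((A - B) \<union> (B - A)) C)"
proof
  fix C
  have "(\<Sum>A'\<in>Pow {1..r}. \<Sum>B'\<in>Pow {1..r}. unit_fun A A' * unit_fun B B' *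
          blade_sign A' B' * unit_fun ((A' - B') \<union> (B' - A')) C)
     = blade_sign A B * unit_fun ((A - B) \<union> (B - A)) C"
    using assms
    by (simp add: mult.assoc sum_distrib_left[symmetric] sum_unit_fun del: One_nat_def)
  then show "(unit_fun A \<otimes>\<^bsub>clifford_algebra r\<^esub> unit_fun B) C =
      blade_sign A B * unit_fun ((A - B) \<union> (B - A)) C"
    by (simp add: clifford_algebra_def)
qed

lemma blade_sign_singleton: "blade_sign {i} {j} = (if j < i then -1 else 1)"
proof -
  have "{(a, b). a \<in> {i} \<and> b \<in> {j} \<and> b < a} = (if j < i then {(i, j)} else {})" by auto
  then show ?thesis by (simp add: blade_sign_def)
qed

lemma clifford_gen_square:
  assumes "i \<in> {1..r}"
  shows "clifford_gen i \<otimes>\<^bsub>clifford_algebra r\<^esub> clifford_gen i = \<one>\<^bsub>clifford_algebra r\<^esub>"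
  using assms by (simp add: clifford_gen_def clifford_mult_unit_fun blade_sign_singleton)
    (simp add: clifford_algebra_def)

lemma clifford_gen_anticommute:
  assumes "i \<in> {1..r}" "j \<in> {1..r}" "i \<noteq> j"
  shows "clifford_gen i \<otimes>\<^bsub>clifford_algebra r\<^esub> clifford_gen j =
    (\<lambda>C. - (clifford_gen j \<otimes>\<^bsub>clifford_algebra r\<^esub> clifford_gen i) C)"
  using assms by (auto simp: clifford_gen_def clifford_mult_unit_fun blade_sign_singleton
      insert_commute insert_Diff_if)

definition pure_tensor :: "('i \<Rightarrow> real) \<Rightarrow> ('j \<Rightarrow> real) \<Rightarrow> 'i \<times> 'j \<Rightarrow> real" where
  "pure_tensor x y = (\<lambda>(i, j). x i * y j)"

text \<open>
  The ungraded tensor product of two real algebras whose underlying spaces are coordinate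
  spaces over finite index sets \<open>I\<close> and \<open>J\<close>: the multiplication is the bilinear extension of
  \<open>(a \<otimes> b) (a' \<otimes> b') = (a a') \<otimes> (b b')\<close> on the basis vectors.
\<close>

definition tensor_algebra ::
  "'i set \<Rightarrow> 'j set \<Rightarrow> (real, 'i \<Rightarrow> real) module \<Rightarrow> (real, 'j \<Rightarrow> real) module
    \<Rightarrow> (real, 'i \<times> 'j \<Rightarrow> real) module" where
  "tensor_algebra I J M N =
    \<lparr> carrier = {x. \<forall>k. x k \<noteq> 0 \<longrightarrow> k \<in> I \<times> J},
      monoid.mult = (\<lambda>x y k. \<Sum>(i, j)\<in>I \<times> J. \<Sum>(i', j')\<in>I \<times> J.
        x (i, j) * y (i', j') *
        pure_tensor (unit_fun i \<otimes>\<^bsub>M\<^esub> unit_fun i') (unit_fun j \<otimes>\<^bsub>N\<^esub> unit_fun j') k),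
      one = pure_tensor \<one>\<^bsub>M\<^esub> \<one>\<^bsub>N\<^esub>,
      zero = (\<lambda>k. 0),
      add = (\<lambda>x y k. x k + y k),
      smult = (\<lambda>c x k. c * x k) \<rparr>"

definition clifford_tensor :: "nat \<Rightarrow> nat \<Rightarrow> (real, nat set \<times> nat set \<Rightarrow> real) module" where
  "clifford_tensor p q =
    tensor_algebra (Pow {1..p}) (Pow {1..q}) (clifford_algebra p) (clifford_algebra q)"

lemma pure_tensor_unit_fun: "pure_tensor (unit_fun A) (unit_fun B) = unit_fun (A, B)"
  by (auto simp: pure_tensor_def unit_fun_def)

lemma clifford_tensor_mult_unit_fun:
  assumes "A \<subseteq> {1..p}" "B \<subseteq> {1..q}" "A' \<subseteq> {1..p}" "B' \<subseteq> {1..q}"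
  shows "pure_tensor (unit_fun A) (unit_fun B) \<otimes>\<^bsub>clifford_tensor p q\<^esub>
      pure_tensor (unit_fun A') (unit_fun B') =
    pure_tensor (unit_fun A \<otimes>\<^bsub>clifford_algebra p\<^esub> unit_fun A')
      (unit_fun B \<otimes>\<^bsub>clifford_algebra q\<^esub> unit_fun B')"
    (is "_ = ?R")
proof
  fix k
  let ?I = "Pow {1..p} \<times> Pow {1..q}"
  let ?T = "\<lambda>s t. pure_tensor (unit_fun (fst s) \<otimes>\<^bsub>clifford_algebra p\<^esub> unit_fun (fst t))
    (unit_fun (snd s) \<otimes>\<^bsub>clifford_algebra q\<^esub> unit_fun (snd t)) k"
  have "(\<Sum>s\<in>?I. \<Sum>t\<in>?I. unit_fun (A, B) s * unit_fun (A', B') t * ?T s t) = ?R k"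
    using assms
    by (simp add: mult.assoc sum_distrib_left[symmetric] sum_unit_fun del: One_nat_def)
  then show "(pure_tensor (unit_fun A) (unit_fun B) \<otimes>\<^bsub>clifford_tensor p q\<^esub>
      pure_tensor (unit_fun A') (unit_fun B')) k = ?R k"
    by (simp add: clifford_tensor_def tensor_algebra_def pure_tensor_unit_fun case_prod_unfold)
qed

text \<open>
  The generators \<open>e\<^sub>1, \<dots>, e\<^sub>p\<close> of the first factor and \<open>e\<^sub>p\<^sub>+\<^sub>1, \<dots>, e\<^sub>p\<^sub>+\<^sub>q\<close> of the second one.
\<close>

definition tensor_gen :: "nat \<Rightarrow> nat \<Rightarrow> nat \<Rightarrow> nat set \<times> nat set \<Rightarrow> real" where
  "tensor_gen p q i =
    (if i \<le> p then pure_tensor (clifford_gen i) \<one>\<^bsub>clifford_algebra q\<^esub>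
     else pure_tensor \<one>\<^bsub>clifford_algebra p\<^esub> (clifford_gen (i - p)))"

section \<open>Representations\<close>

definition matrix_algebra :: "(real, real^'m^'m) module" where
  "matrix_algebra =
    \<lparr> carrier = UNIV, monoid.mult = (**), one = mat 1, zero = 0, add = (+), smult = (*\<^sub>R) \<rparr>"

text \<open>A unital homomorphism of real algebras into the real \<open>m \<times> m\<close> matrices, \<open>m = CARD('m)\<close>.\<close>

definition representation ::
  "nat \<Rightarrow> nat \<Rightarrow> ((nat set \<times> nat set \<Rightarrow> real) \<Rightarrow> real^'m^'m) \<Rightarrow> bool" where
  "representation p q \<rho> \<longleftrightarrow>
    \<rho> \<in> ring_hom (clifford_tensor p q) matrix_algebra \<and>
    (\<forall>c. \<forall>x\<in>carrier (clifford_tensor p q).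
      \<rho> (c \<odot>\<^bsub>clifford_tensor p q\<^esub> x) = c \<odot>\<^bsub>matrix_algebra\<^esub> \<rho> x)"

definition basis_matrices ::
  "nat \<Rightarrow> nat \<Rightarrow> ((nat set \<times> nat set \<Rightarrow> real) \<Rightarrow> real^'m^'m) \<Rightarrow> nat \<Rightarrow> real^'m^'m" where
  "basis_matrices p q \<rho> i = \<rho> (tensor_gen p q i)"

section \<open>The quadratic mapping and its degeneracy\<close>

text \<open>
  \<open>S[w] = \<^sup>tw S w\<close>, without complex conjugation over the complex numbers.
\<close>

definition quad_val :: "'a::comm_ring_1^'m^'m \<Rightarrow> 'a^'m \<Rightarrow> 'a" where
  "quad_val A w = (\<Sum>a\<in>UNIV. w $ a * (A *v w) $ a)"

text \<open>
  Vectors with \<open>n\<close> coordinates are functions on the natural numbers that vanish outside \<open>{1..n}\<close>.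
\<close>

definition quad_map :: "nat \<Rightarrow> (nat \<Rightarrow> 'a::comm_ring_1^'m^'m) \<Rightarrow> 'a^'m \<Rightarrow> nat \<Rightarrow> 'a" where
  "quad_map n S w = (\<lambda>i. if i \<in> {1..n} then quad_val (S i) w else 0)"

definition sig_form :: "nat \<Rightarrow> nat \<Rightarrow> (nat \<Rightarrow> 'a::comm_ring_1) \<Rightarrow> 'a" where
  "sig_form p q v = (\<Sum>i\<in>{1..p}. (v i)\<^sup>2) - (\<Sum>i\<in>{p+1..p+q}. (v i)\<^sup>2)"

definition clifford_quartic ::
  "nat \<Rightarrow> nat \<Rightarrow> (nat \<Rightarrow> 'a::comm_ring_1^'m^'m) \<Rightarrow> 'a^'m \<Rightarrow> 'a" where
  "clifford_quartic p q S w = sig_form p q (quad_map (p + q) S w)"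

definition complexify :: "(nat \<Rightarrow> real^'m^'m) \<Rightarrow> nat \<Rightarrow> complex^'m^'m" where
  "complexify S i = map_matrix complex_of_real (S i)"

text \<open>
  The differential at \<open>w\<close>, taken coordinate by coordinate. The Frechet derivative is by
  definition real linear, but since the coordinates are complex polynomials it is complex
  linear and agrees with the complex differential.
\<close>

definition differential ::
  "(complex^'m \<Rightarrow> nat \<Rightarrow> complex) \<Rightarrow> complex^'m \<Rightarrow> complex^'m \<Rightarrow> nat \<Rightarrow> complex" where
  "differential F w h = (\<lambda>i. frechet_derivative (\<lambda>z. F z i) (at w) h)"

definition complex_rank :: "(complex^'m \<Rightarrow> nat \<Rightarrow> complex) \<Rightarrow> nat" where
  "complex_rank L = vector_space.dim (\<lambda>(c::complex) v i. c * v i) (range L)"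

lemma vector_space_coordinates: "vector_space (\<lambda>(c::complex) (v::nat \<Rightarrow> complex) i. c * v i)"
  by unfold_locales (auto simp: algebra_simps fun_eq_iff)

definition nondegenerate :: "nat \<Rightarrow> nat \<Rightarrow> (nat \<Rightarrow> real^'m^'m) \<Rightarrow> bool" where
  "nondegenerate p q S \<longleftrightarrow>
    (let U = {w. sig_form p q (quad_map (p + q) (complexify S) w) \<noteq> 0}
     in U \<noteq> {} \<and>
        (\<forall>w\<in>U. complex_rank (differential (quad_map (p + q) (complexify S)) w) = p + q))"

abbreviation degenerate :: "nat \<Rightarrow> nat \<Rightarrow> (nat \<Rightarrow> real^'m^'m) \<Rightarrow> bool" where
  "degenerate p q S \<equiv> \<not> nondegenerate p q S"

end

theory Submission
  imports Defs
begin

text \<open>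
  Write \<open>n = p + q\<close> and \<open>\<epsilon>\<^sub>i = \<plusminus>1\<close> for the signs of \<open>P\<close>. Where the quartic does not vanish, the
  \<open>Spin(p, q)\<close>-equivariance of \<open>Q\<close> together with the Euler field shows that the differential of \<open>Q\<close>
  is onto, so degeneracy means that the quartic vanishes; differentiating the quartic then gives the
  cubic relations. Conversely, polarize a relation \<open>\<Sum>\<^sub>i S\<^sub>i[w] \<langle>a\<^sub>i, w\<rangle> = 0\<close> and contract it with \<open>S\<^sub>j\<close>:
  except for \<open>(p, q) = (1, 1)\<close>, all traces of \<open>S\<^sub>i S\<^sub>j\<close> with \<open>i \<noteq> j\<close> vanish, and \<open>b\<^sub>j = S\<^sub>j a\<^sub>j\<close> satisfies
  \<open>(m + 4) b\<^sub>j = 2 \<epsilon>\<^sub>j \<Sum>\<^sub>i \<epsilon>\<^sub>i b\<^sub>i\<close>, which forces \<open>m + 4 = 2n\<close>. The squared norm of the symmetric tensor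
  of the quartic is a positive multiple of \<open>m n (m + 4 - 2n)\<close>, so this equation is also sufficient
  for the vanishing of the quartic. The solutions are cut down to the list by two facts: the trace of
  the Hessian of a vanishing quartic gives \<open>p = q\<close> unless \<open>q = 1\<close>, and \<open>m\<close> is divisible by
  \<open>2\<close> to the power \<open>\<lfloor>p/2\<rfloor> + \<lfloor>q/2\<rfloor>\<close>.
\<close>

section \<open>Clifford systems\<close>

lemma scalar_product_add: "scalar_product u (v + w) = scalar_product u v + scalar_product u w"
    and scalar_product_add_left: "scalar_product (u + v) w = scalar_product u w + scalar_product v w"
  by (simp_all add: scalar_product_def distrib_left distrib_right sum.distrib)

lemma scalar_product_scale:
    fixes u :: "'a::comm_ring_1^'n"
    shows "scalar_product u (c *s v) = c * scalar_product u v"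
    and "scalar_product (c *s u) v = c * scalar_product u v"
  by (simp_all add: scalar_product_def sum_distrib_left mult_ac)

lemma scalar_product_uminus:
    fixes u :: "'a::comm_ring_1^'n"
    shows "scalar_product u (- v) = - scalar_product u v"
    and "scalar_product (- u) v = - scalar_product u v"
  by (simp_all add: scalar_product_def sum_negf)

lemma scalar_product_sum:
  "scalar_product u (\<Sum>i\<in>I. f i) = (\<Sum>i\<in>I. scalar_product u (f i))"
proof (induction I rule: infinite_finite_induct)
qed (simp_all add: scalar_product_add, simp_all add: scalar_product_def)

lemma scalar_product_commute: "scalar_product u v = scalar_product v (u :: 'a::comm_ring_1^'n)"
  by (simp add: scalar_product_def mult.commute)

lemma scalar_product_axis: "scalar_product (axis a 1) v = v $ a"
  by (simp add: scalar_product_def axis_def if_distrib[where f = "\<lambda>x. x * _"] cong: if_cong)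

lemma scalar_product_transpose:
  fixes A :: "'a::comm_ring_1^'m^'m"
  shows "scalar_product (A *v u) v = scalar_product u (transpose A *v v)"
  unfolding scalar_product_def matrix_vector_mult_def transpose_def
  by (simp add: sum_distrib_left sum_distrib_right mult_ac) (rule sum.swap)

lemma quad_val_scalar_product: "quad_val A w = scalar_product w (A *v w)"
  by (simp add: quad_val_def scalar_product_def)

lemma matrix_vector_mult_uminus: "(- A) *v (x :: 'a::comm_ring_1^'n) = - (A *v x)"
  by (simp add: matrix_vector_mult_def vec_eq_iff sum_negf)

text \<open>The sign that P gives to the i-th square. For distinct i, j the product of their signs
  is 1 when \<open>S i\<close> and \<open>S j\<close> anticommute and -1 when they commute.\<close>

definition sig_sign :: "nat \<Rightarrow> nat \<Rightarrow> 'a::comm_ring_1" where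
  "sig_sign p i = (if i \<le> p then 1 else - 1)"

lemma sig_sign_mult [simp]: "sig_sign p i * sig_sign p i = 1"
  "sig_sign p i * (sig_sign p i * x) = x"
  by (simp_all add: sig_sign_def)

lemma sum_split_sig:
  "(\<Sum>i\<in>{1..p+q}. f i) = (\<Sum>i\<in>{1..p}. f i) + (\<Sum>i\<in>{p+1..p+q}. f i)"
  for f :: "nat \<Rightarrow> 'a::comm_monoid_add"
  using sum.ub_add_nat[of 1 p f q] by simp

lemma sig_form_alt: "sig_form p q v = (\<Sum>i\<in>{1..p+q}. sig_sign p i * (v i)\<^sup>2)"
  unfolding sig_form_def sum_split_sig by (simp add: sig_sign_def sum_negf)

lemma clifford_quartic_alt:
  "clifford_quartic p q S w = (\<Sum>i\<in>{1..p+q}. sig_sign p i * (quad_val (S i) w)\<^sup>2)"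
  by (simp add: clifford_quartic_def sig_form_alt quad_map_def)

text \<open>These relations are all that is used of a representation later on. The field stays
  general so that the same lemmas serve the real matrices and their complexifications.\<close>

locale clifford_system =
  fixes p q :: nat and S :: "nat \<Rightarrow> 'a::field_char_0^'m^'m"
  assumes symmetric: "i \<in> {1..p+q} \<Longrightarrow> transpose (S i) = S i"
    and square: "i \<in> {1..p+q} \<Longrightarrow> S i ** S i = mat 1"
    and anticommute: "i \<in> {1..p+q} \<Longrightarrow> j \<in> {1..p+q} \<Longrightarrow> i \<noteq> j \<Longrightarrow> i \<le> p \<longleftrightarrow> j \<le> p
      \<Longrightarrow> S i ** S j = - (S j ** S i)"
    and commute: "i \<in> {1..p+q} \<Longrightarrow> j \<in> {1..p+q} \<Longrightarrow> (i \<le> p) \<noteq> (j \<le> p) \<Longrightarrow> S i ** S j = S j ** S i"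
begin

abbreviation \<epsilon> :: "nat \<Rightarrow> 'a" where "\<epsilon> \<equiv> sig_sign p"

lemma square_vec: "i \<in> {1..p+q} \<Longrightarrow> S i *v (S i *v w) = w"
  by (simp only: matrix_vector_mul_assoc square matrix_vector_mul_lid)

lemma swap_vec:
  assumes "i \<in> {1..p+q}" "j \<in> {1..p+q}" "i \<noteq> j"
  shows "S i *v (S j *v w) = (- (\<epsilon> i * \<epsilon> j)) *s (S j *v (S i *v w))"
proof (cases "i \<le> p \<longleftrightarrow> j \<le> p")
  case True
  then have "\<epsilon> i * \<epsilon> j = 1" by (auto simp: sig_sign_def)
  then show ?thesis using True assms
    by (simp add: matrix_vector_mul_assoc anticommute[of i j] matrix_vector_mult_uminus)
next
  case False
  then have "\<epsilon> i * \<epsilon> j = -1" by (auto simp: sig_sign_def)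
  then show ?thesis using False assms commute[of i j]
    by (simp add: matrix_vector_mul_assoc)
qed

lemma self_adjoint:
  "i \<in> {1..p+q} \<Longrightarrow> scalar_product (S i *v u) v = scalar_product u (S i *v v)"
  by (simp add: scalar_product_transpose symmetric)

lemma isometry:
  "i \<in> {1..p+q} \<Longrightarrow> scalar_product (S i *v u) (S i *v v) = scalar_product u v"
  by (simp add: self_adjoint square_vec)

text \<open>Reversing the product of three distinct matrices costs one sign for each pair, in total
  \<open>- (\<epsilon> i * \<epsilon> j * \<epsilon> k)\<^sup>2 = -1\<close>. The reversed product
  is also the transpose, so the product is skew-symmetric and its quadratic form vanishes.\<close>

lemma scalar_product_triple_eq_0:
  assumes "i \<in> {1..p+q}" "j \<in> {1..p+q}" "k \<in> {1..p+q}" "i \<noteq> j" "j \<noteq> k" "i \<noteq> k"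
  shows "scalar_product w (S i *v (S j *v (S k *v w))) = 0"
proof -
  have "S k *v (S j *v (S i *v w)) = - (S i *v (S j *v (S k *v w)))"
  proof -
    have "S k *v (S j *v (S i *v w)) =
      (- (\<epsilon> k * \<epsilon> j)) *s (S j *v ((- (\<epsilon> k * \<epsilon> i)) *s (S i *v (S k *v w))))"
      using assms by (subst swap_vec) (auto simp: swap_vec[of k i w])
    also have "\<dots> = (\<epsilon> j * \<epsilon> i) *s (S j *v (S i *v (S k *v w)))"
      by (simp add: vec.scale vec.neg mult_ac)
    also have "\<dots> = - (S i *v (S j *v (S k *v w)))"
      using assms by (subst swap_vec[of j i]) (auto simp: mult_ac)
    finally show ?thesis .
  qed
  moreover have "scalar_product w (S i *v (S j *v (S k *v w))) =
      scalar_product w (S k *v (S j *v (S i *v w)))"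
    using assms(1-3) by (subst scalar_product_commute) (simp add: self_adjoint)
  ultimately have "scalar_product w (S i *v (S j *v (S k *v w))) =
      - scalar_product w (S i *v (S j *v (S k *v w)))"
    using scalar_product_scale(1)[of w "-1" "S i *v (S j *v (S k *v w))"] by simp
  then show ?thesis by simp
qed

text \<open>
  The Lie algebra elements \<open>S j ** S k\<close> act on \<open>W\<close> so that \<open>Q\<close> is equivariant for \<open>Spin(p, q)\<close>; this
  combination of them with the Euler field is the direction that the differential of \<open>Q\<close> at \<open>w\<close>
  maps to a multiple of the \<open>j\<close>-th unit vector.
\<close>

definition adjoint_vec :: "'a^'m \<Rightarrow> nat \<Rightarrow> 'a^'m" where
  "adjoint_vec w j = S j *v (\<Sum>k\<in>{1..p+q}. (\<epsilon> k * quad_val (S k) w) *s (S k *v w))"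

text \<open>For i = j the terms are exactly those of the quartic. For distinct i and j, every k
  outside \<open>{i, j}\<close> contributes 0 by skew-symmetry of the triple product, and the terms
  k = i and k = j cancel.\<close>

lemma scalar_product_adjoint_vec:
  assumes "i \<in> {1..p+q}" "j \<in> {1..p+q}"
  shows "scalar_product (S i *v w) (adjoint_vec w j) =
    (if i = j then clifford_quartic p q S w else 0)"
proof -
  define N where "N k = scalar_product w (S i *v (S j *v (S k *v w)))" for k
  have *: "scalar_product (S i *v w) (adjoint_vec w j) = (\<Sum>k\<in>{1..p+q}. \<epsilon> k * quad_val (S k) w * N k)"
    using assms
    by (simp add: adjoint_vec_def self_adjoint vec.sum vec.scale scalar_product_sum
        scalar_product_scale N_def)
  show ?thesis
  proof (cases "i = j")
    case True
    then show ?thesis using assms unfolding *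
      by (simp add: N_def square_vec clifford_quartic_alt power2_eq_square mult.assoc
          quad_val_scalar_product del: atLeastAtMost_iff)
  next
    case False
    have Ni: "N i = - (\<epsilon> i * \<epsilon> j * quad_val (S j) w)"
      using assms False
      by (simp add: N_def swap_vec[of j i] vec.scale vec.neg square_vec scalar_product_scale
          scalar_product_uminus quad_val_scalar_product mult_ac)
    have Nj: "N j = quad_val (S i) w"
      using assms by (simp add: N_def square_vec quad_val_scalar_product)
    have "(\<Sum>k\<in>{1..p+q}. \<epsilon> k * quad_val (S k) w * N k) =
        (\<Sum>k\<in>{i,j}. \<epsilon> k * quad_val (S k) w * N k)"
      using assms False by (intro sum.mono_neutral_right) (auto simp: N_def scalar_product_triple_eq_0)
    also have "\<dots> = 0"
      using False by (simp add: Ni Nj mult_ac)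
    finally show ?thesis using * False by simp
  qed
qed

end

section \<open>Representations, complexification and the differential\<close>

lemma blade_sign_empty [simp]: "blade_sign {} B = 1" "blade_sign A {} = 1"
  by (simp_all add: blade_sign_def)

text \<open>Basis blades multiply to signed blades and \<open>\<rho>\<close> respects products and
  scalars, so every relation among the basis matrices becomes a computation of signs.\<close>

lemma representation_blade_mult:
  assumes \<rho>: "representation p q \<rho>"
    and "A \<subseteq> {1..p}" "B \<subseteq> {1..q}" "A' \<subseteq> {1..p}" "B' \<subseteq> {1..q}"
  shows "\<rho> (unit_fun (A, B)) ** \<rho> (unit_fun (A', B')) = (blade_sign A A' * blade_sign B B') *\<^sub>R
    \<rho> (unit_fun ((A - A') \<union> (A' - A), (B - B') \<union> (B' - B)))"
proof -
  let ?T = "clifford_tensor p q"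
  let ?D = "((A - A') \<union> (A' - A), (B - B') \<union> (B' - B))"
  have carrier: "unit_fun (X, Y) \<in> carrier ?T" if "X \<subseteq> {1..p}" "Y \<subseteq> {1..q}" for X Y
    using that by (simp add: clifford_tensor_def tensor_algebra_def unit_fun_def)
  have "unit_fun (A, B) \<otimes>\<^bsub>?T\<^esub> unit_fun (A', B') =
      (blade_sign A A' * blade_sign B B') \<odot>\<^bsub>?T\<^esub> unit_fun ?D"
    using assms(2-5)
    by (simp add: clifford_tensor_mult_unit_fun clifford_mult_unit_fun flip: pure_tensor_unit_fun)
      (auto simp: clifford_tensor_def tensor_algebra_def pure_tensor_def unit_fun_def fun_eq_iff)
  moreover have "\<rho> (unit_fun (A, B)) ** \<rho> (unit_fun (A', B')) =
      \<rho> (unit_fun (A, B) \<otimes>\<^bsub>?T\<^esub> unit_fun (A', B'))"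
    using \<rho> carrier[OF assms(2,3)] carrier[OF assms(4,5)] ring_hom_mult[of \<rho> ?T matrix_algebra]
    by (simp add: representation_def matrix_algebra_def)
  ultimately have "\<rho> (unit_fun (A, B)) ** \<rho> (unit_fun (A', B')) =
      \<rho> ((blade_sign A A' * blade_sign B B') \<odot>\<^bsub>?T\<^esub> unit_fun ?D)"
    by simp
  also have "\<dots> = (blade_sign A A' * blade_sign B B') *\<^sub>R \<rho> (unit_fun ?D)"
  proof -
    have "unit_fun ?D \<in> carrier ?T"
      using assms(2-5) by (intro carrier) auto
    then show ?thesis
      using \<rho> by (simp add: representation_def matrix_algebra_def)
  qed
  finally show ?thesis .
qed

lemma tensor_gen_blade:
  "tensor_gen p q i = unit_fun (if i \<le> p then ({i}, {}) else ({}, {i - p}))"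
proof -
  have "\<one>\<^bsub>clifford_algebra r\<^esub> = unit_fun {}" for r
    by (simp add: clifford_algebra_def)
  then show ?thesis
    by (simp add: tensor_gen_def clifford_gen_def pure_tensor_unit_fun)
qed

lemma clifford_system_basis_matrices:
  fixes \<rho> :: "(nat set \<times> nat set \<Rightarrow> real) \<Rightarrow> real^'m^'m"
  assumes \<rho>: "representation p q \<rho>"
    and sym: "\<And>i. i \<in> {1..p+q} \<Longrightarrow> transpose (basis_matrices p q \<rho> i) = basis_matrices p q \<rho> i"
  shows "clifford_system p q (basis_matrices p q \<rho>)"
proof
  let ?S = "basis_matrices p q \<rho>"
  have one: "\<rho> (unit_fun ({}, {})) = mat 1"
  proof -
    have "unit_fun ({}, {}) = \<one>\<^bsub>clifford_tensor p q\<^esub>"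
      by (simp add: clifford_tensor_def tensor_algebra_def clifford_algebra_def pure_tensor_unit_fun)
    then show ?thesis using \<rho> ring_hom_one[of \<rho> "clifford_tensor p q" matrix_algebra]
      by (simp add: representation_def matrix_algebra_def)
  qed
  note simps = basis_matrices_def tensor_gen_blade representation_blade_mult[OF \<rho>] one blade_sign_singleton
  fix i j
  assume i: "i \<in> {1..p+q}"
  then show "transpose (?S i) = ?S i" by (rule sym)
  \<comment> \<open>Natural subtraction truncates at 0, so the second bound also holds when i is at
    most p.\<close>
  have ip: "\<not> i \<le> p \<Longrightarrow> Suc 0 \<le> i - p" "i - p \<le> q"
    using i by auto
  show "?S i ** ?S i = mat 1"
    using i ip by (auto simp: simps)
  assume j: "j \<in> {1..p+q}"
  then have jp: "\<not> j \<le> p \<Longrightarrow> Suc 0 \<le> j - p" "j - p \<le> q"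
    by auto
  {
    assume "i \<noteq> j" "i \<le> p \<longleftrightarrow> j \<le> p"
    then show "?S i ** ?S j = - (?S j ** ?S i)"
      using i j ip jp by (cases "i \<le> p") (auto simp: simps insert_commute insert_Diff_if)
  next
    assume "(i \<le> p) \<noteq> (j \<le> p)"
    then show "?S i ** ?S j = ?S j ** ?S i"
      using i j ip jp by (cases "i \<le> p") (auto simp: simps)
  }
qed

section \<open>Complexification\<close>

lemma complexify_mult: "map_matrix complex_of_real (A ** B) = map_matrix complex_of_real A ** map_matrix complex_of_real B"
  by (simp add: vec_eq_iff matrix_matrix_mult_def)

lemma clifford_system_complexify:
  assumes "clifford_system p q S"
  shows "clifford_system p q (complexify S)"
proof -
  interpret clifford_system p q S by fact
  have m1: "map_matrix complex_of_real (mat 1) = mat 1"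
    by (simp add: vec_eq_iff mat_def)
  have mm: "map_matrix complex_of_real (- A) = - map_matrix complex_of_real A" for A :: "real^'x^'y"
    by (simp add: vec_eq_iff)
  show ?thesis
  proof
    fix i j assume i: "i \<in> {1..p+q}"
    show "transpose (complexify S i) = complexify S i"
      using symmetric[OF i] by (simp add: complexify_def transpose_def vec_eq_iff)
    show "complexify S i ** complexify S i = mat 1"
      using square[OF i] by (simp add: complexify_def m1 flip: complexify_mult)
    assume j: "j \<in> {1..p+q}"
    {
      assume "i \<noteq> j" "i \<le> p \<longleftrightarrow> j \<le> p"
      then show "complexify S i ** complexify S j = - (complexify S j ** complexify S i)"
        using anticommute[OF i j] by (simp add: complexify_def flip: complexify_mult mm)
    next
      assume "(i \<le> p) \<noteq> (j \<le> p)"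
      then show "complexify S i ** complexify S j = complexify S j ** complexify S i"
        using commute[OF i j] by (simp add: complexify_def flip: complexify_mult)
    }
  qed
qed

section \<open>The differential of the quadratic mapping and its rank\<close>

lemma differential_quad_map:
  fixes S :: "nat \<Rightarrow> complex^'m^'m"
  assumes sym: "\<And>i. i \<in> {1..n} \<Longrightarrow> transpose (S i) = S i"
  shows "differential (quad_map n S) w h i =
    (if i \<in> {1..n} then 2 * scalar_product (S i *v w) h else 0)"
proof (cases "i \<in> {1..n}")
  case False
  then show ?thesis
    by (auto simp: differential_def quad_map_def frechet_derivative_const)
next
  case True
  have "((\<lambda>z. quad_val (S i) z) has_derivative
      (\<lambda>h. \<Sum>a\<in>UNIV. w $ a * (\<Sum>b\<in>UNIV. S i $ a $ b * h $ b)
        + h $ a * (\<Sum>b\<in>UNIV. S i $ a $ b * w $ b))) (at w)"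
    unfolding quad_val_def matrix_vector_mult_def vec_lambda_beta
    by (intro derivative_eq_intros refl)
      (simp_all add: mult_ac bounded_linear_imp_has_derivative bounded_linear_vec_nth)
  also have "(\<lambda>h. \<Sum>a\<in>UNIV. w $ a * (\<Sum>b\<in>UNIV. S i $ a $ b * h $ b)
        + h $ a * (\<Sum>b\<in>UNIV. S i $ a $ b * w $ b)) = (\<lambda>h. 2 * scalar_product (S i *v w) h)"
  proof
    fix h
    have "(\<Sum>a\<in>UNIV. w $ a * (\<Sum>b\<in>UNIV. S i $ a $ b * h $ b)
        + h $ a * (\<Sum>b\<in>UNIV. S i $ a $ b * w $ b)) =
        scalar_product w (S i *v h) + scalar_product h (S i *v w)"
      by (simp add: scalar_product_def matrix_vector_mult_def sum.distrib)
    \<comment> \<open>By symmetry of \<open>S i\<close> the two terms of the product rule agree,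
      whence the factor 2.\<close>
    also have "scalar_product w (S i *v h) = scalar_product (S i *v w) h"
      by (simp add: scalar_product_transpose sym[OF True])
    finally show "(\<Sum>a\<in>UNIV. w $ a * (\<Sum>b\<in>UNIV. S i $ a $ b * h $ b)
        + h $ a * (\<Sum>b\<in>UNIV. S i $ a $ b * w $ b)) = 2 * scalar_product (S i *v w) h"
      by (simp add: scalar_product_commute)
  qed
  finally show ?thesis using True
    by (simp add: differential_def quad_map_def frechet_derivative_at[symmetric])
qed

text \<open>The range of \<open>L\<close> contains the first n unit vectors and lies in their span,
  so they form a basis of it.\<close>

lemma complex_rank_full:
  assumes supp: "\<And>h i. i \<notin> {1..n} \<Longrightarrow> L h i = 0"
    and unit: "\<And>j. j \<in> {1..n} \<Longrightarrow> \<exists>h. \<forall>i. L h i = (if i = j then 1 else 0)"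
  shows "complex_rank L = n"
proof -
  interpret V: vector_space "\<lambda>(c::complex) (v::nat \<Rightarrow> complex) i. c * v i"
    by (rule vector_space_coordinates)
  define e where "e j = (\<lambda>i. if i = j then 1 else (0::complex))" for j :: nat
  have inj: "inj_on e {1..n}"
    by (auto simp: inj_on_def e_def fun_eq_iff split: if_splits)
  have sum_apply: "(\<Sum>j\<in>J. f j) i = (\<Sum>j\<in>J. f j i)" for f :: "nat \<Rightarrow> nat \<Rightarrow> complex" and J i
    by (induction J rule: infinite_finite_induct) auto
  have "V.dim (range L) = n"
  proof (rule V.dim_unique)
    show "e ` {1..n} \<subseteq> range L"
    proof
      fix v assume "v \<in> e ` {1..n}"
      then obtain j where j: "j \<in> {1..n}" "v = e j" by blast
      then obtain h where "\<forall>i. L h i = (if i = j then 1 else 0)" using unit by blast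
      then have "L h = v" using j by (auto simp: e_def)
      then show "v \<in> range L" by blast
    qed
    show "range L \<subseteq> V.span (e ` {1..n})"
    proof
      fix v assume "v \<in> range L"
      then have v: "v i = 0" if "i \<notin> {1..n}" for i using that supp by auto
      have "v = (\<Sum>j\<in>{1..n}. (\<lambda>i. v j * e j i))"
      proof
        fix i
        have "(\<Sum>j\<in>{1..n}. v j * e j i) = (\<Sum>j\<in>{1..n}. if j = i then v j else 0)"
          by (rule sum.cong) (auto simp: e_def)
        then show "v i = (\<Sum>j\<in>{1..n}. (\<lambda>i. v j * e j i)) i"
          using v[of i] by (auto simp: sum_apply)
      qed
      also have "\<dots> \<in> V.span (e ` {1..n})"
        by (intro V.span_sum V.span_scale V.span_base imageI)
      finally show "v \<in> V.span (e ` {1..n})" .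
    qed
    show "V.independent (e ` {1..n})"
    proof (rule V.independent_if_scalars_zero)
      fix f v assume sum0: "(\<Sum>x\<in>e ` {1..n}. (\<lambda>i. f x * x i)) = 0" and "v \<in> e ` {1..n}"
      then obtain j where j: "j \<in> {1..n}" "v = e j" by blast
      have "0 = (\<Sum>k\<in>{1..n}. (\<lambda>i. f (e k) * e k i)) j"
        using sum0 inj by (simp add: sum.reindex o_def)
      also have "\<dots> = (\<Sum>k\<in>{1..n}. if k = j then f (e k) else 0)"
        unfolding sum_apply by (rule sum.cong) (auto simp: e_def)
      also have "\<dots> = f v" using j by simp
      finally show "f v = 0" by simp
    qed simp
    show "card (e ` {1..n}) = n" using inj by (simp add: card_image)
  qed
  then show ?thesis by (simp add: complex_rank_def)
qed

text \<open>A real point with nonzero value shows that the open set is non-empty. At every complex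
  point of that set, \<open>adjoint_vec\<close> divided by twice the quartic is mapped by the
  differential to the j-th unit vector, so the rank is full.\<close>

lemma nondegenerateI:
  fixes S :: "nat \<Rightarrow> real^'m^'m"
  assumes "clifford_system p q S" "clifford_quartic p q S w \<noteq> 0"
  shows "nondegenerate p q S"
proof -
  interpret C: clifford_system p q "complexify S"
    by (rule clifford_system_complexify) fact
  have "quad_val (complexify S i) (\<chi> a. of_real (w $ a)) = of_real (quad_val (S i) w)" for i
    by (simp add: quad_val_def matrix_vector_mult_def complexify_def)
  then have "clifford_quartic p q (complexify S) (\<chi> a. of_real (w $ a)) =
      of_real (clifford_quartic p q S w)"
    by (simp add: clifford_quartic_alt sig_sign_def if_distrib[where f = of_real] cong: if_cong)
  with assms(2) have "\<exists>z. clifford_quartic p q (complexify S) z \<noteq> 0"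
    by (metis of_real_eq_0_iff)
  moreover have diff: "differential (quad_map (p + q) (complexify S)) z h i =
      (if i \<in> {1..p+q} then 2 * scalar_product (complexify S i *v z) h else 0)" for z h i
    by (rule differential_quad_map) (rule C.symmetric)
  moreover have "complex_rank (differential (quad_map (p + q) (complexify S)) z) = p + q"
    if z: "clifford_quartic p q (complexify S) z \<noteq> 0" for z
  proof (rule complex_rank_full)
    fix j assume j: "j \<in> {1..p+q}"
    define h where "h = (1 / (2 * clifford_quartic p q (complexify S) z)) *s C.adjoint_vec z j"
    have "differential (quad_map (p + q) (complexify S)) z h i = (if i = j then 1 else 0)" for i
      using j z by (auto simp: diff h_def scalar_product_scale
          C.scalar_product_adjoint_vec)
    then show "\<exists>h. \<forall>i. differential (quad_map (p + q) (complexify S)) z h i = (if i = j then 1 else 0)"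
      by blast
  qed (auto simp: diff)
  ultimately show ?thesis
    by (auto simp: nondegenerate_def Let_def clifford_quartic_def)
qed

section \<open>Divisibility of the dimension\<close>

lemma mat_vector_mult: "mat c *v x = c *s (x :: 'a::comm_ring_1^'n)"
  by (simp add: mat_def matrix_vector_mult_def vec_eq_iff if_distrib[where f = "\<lambda>x. x * _"] cong: if_cong)

lemma mat_mult_mat: "(mat c ** mat d :: 'a::comm_ring_1^'n^'n) = mat (c * d)"
  by (simp add: matrix_eq mat_vector_mult flip: matrix_vector_mul_assoc)

lemma matrix_mult_uminus:
  fixes A :: "'a::comm_ring_1^'n^'n"
  shows "(- A) ** B = - (A ** B)" "A ** (- B) = - (A ** B)"
  by (simp_all add: matrix_matrix_mult_def vec_eq_iff sum_negf)

text \<open>V is the direct sum of the eigenspaces of A for s and -s. The invertible C anticommutes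
  with A, so it maps one onto the other and both have half the dimension.\<close>

lemma eigenspace_halving:
  fixes A C :: "'a::field_char_0^'m^'m"
  assumes V: "vec.subspace V"
    and inv: "\<And>v. v \<in> V \<Longrightarrow> A *v v \<in> V" "\<And>v. v \<in> V \<Longrightarrow> C *v v \<in> V"
    and sq: "A ** A = mat (s\<^sup>2)" "C ** C = mat d" and nz: "s \<noteq> 0" "d \<noteq> 0"
    and anti: "A ** C = - (C ** A)"
  shows "vec.dim V = 2 * vec.dim {v \<in> V. A *v v = s *s v}"
proof -
  define E where "E t = {v \<in> V. A *v v = t *s v}" for t
  have sub: "vec.subspace (E t)" for t
    using V by (auto simp: E_def vec.subspace_def vec.add vec.scale vector_add_ldistrib mult_ac)
  have AA: "A *v (A *v v) = s\<^sup>2 *s v" and CC: "C *v (C *v v) = d *s v"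
    and AC: "A *v (C *v v) = - (C *v (A *v v))" for v
    by (simp_all add: matrix_vector_mul_assoc sq anti mat_vector_mult matrix_vector_mult_uminus)
  have "V = {x + y |x y. x \<in> E s \<and> y \<in> E (- s)}"
  proof (intro equalityI subsetI)
    fix v assume v: "v \<in> V"
    \<comment> \<open>The two eigenprojections of v.\<close>
    define x y where "x = (1/2) *s (v + (1/s) *s (A *v v))" and "y = (1/2) *s (v - (1/s) *s (A *v v))"
    have "x \<in> V" "y \<in> V"
      unfolding x_def y_def using v
      by (auto intro!: vec.subspace_scale[OF V] vec.subspace_add[OF V] vec.subspace_diff[OF V] inv)
    moreover have "A *v x = s *s x" "A *v y = (- s) *s y"
      unfolding x_def y_def using nz
      by (simp_all add: vec.add vec.diff vec.scale AA vec_eq_iff field_simps power2_eq_square)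
    moreover have "v = x + y"
      by (simp add: x_def y_def vec_eq_iff field_simps)
    ultimately show "v \<in> {x + y |x y. x \<in> E s \<and> y \<in> E (- s)}"
      by (auto simp: E_def)
  qed (use V in \<open>auto simp: E_def intro: vec.subspace_add\<close>)
  moreover have "E s \<inter> E (- s) = {0}"
  proof -
    have "v = 0" if "s *s v = (- s) *s v" for v :: "'a^'m"
    proof -
      have "s * v $ i = - (s * v $ i)" for i
        using that by (metis vector_smult_component mult_minus_left)
      then have "s * v $ i = 0" for i by simp
      then show ?thesis using nz by (simp add: vec_eq_iff)
    qed
    then show ?thesis
      using vec.subspace_0[OF sub] by (fastforce simp: E_def)
  qed
  moreover have "(*v) C ` E s = E (- s)"
  proof (intro equalityI subsetI)
    fix u assume "u \<in> (*v) C ` E s"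
    then show "u \<in> E (- s)"
      by (auto simp: E_def AC inv vec.scale)
  next
    fix u assume u: "u \<in> E (- s)"
    have "(1/d) *s (C *v u) \<in> E s"
      using u by (auto simp: E_def vec.scale AC vec.neg mult_ac intro!: vec.subspace_scale[OF V] inv)
    moreover have "u = C *v ((1/d) *s (C *v u))"
      using nz by (simp add: vec.scale CC)
    ultimately show "u \<in> (*v) C ` E s" by blast
  qed
  moreover have "inj_on ((*v) C) (vec.span (E s))"
  proof (rule inj_onI)
    fix x y assume "C *v x = C *v y"
    then have "d *s x = d *s y" by (metis CC)
    then show "x = y" using nz by (simp add: vec_eq_iff)
  qed
  ultimately have "vec.dim (E (- s)) = vec.dim (E s)" "vec.dim V = vec.dim (E s) + vec.dim (E (- s))"
    using vec.dim_image_eq[of "(*v) C" "E s"] vec.dim_sums_Int[OF sub sub, of s "- s"] by auto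
  then show ?thesis by (simp add: E_def)
qed

text \<open>
  On an eigenspace of \<open>A 0\<close> the products \<open>A 1 ** A j\<close> with \<open>j \<ge> 2\<close> form a shorter anticommuting
  family. Allowing arbitrary nonzero scalar squares avoids rescaling these products.
\<close>

lemma anticommuting_family_halving:
  fixes A :: "nat \<Rightarrow> complex^'m^'m"
  assumes "vec.subspace V"
    and "\<And>i v. i < 2 * k \<Longrightarrow> v \<in> V \<Longrightarrow> A i *v v \<in> V"
    and "\<And>i. i < 2 * k \<Longrightarrow> \<exists>c. c \<noteq> 0 \<and> A i ** A i = mat c"
    and "\<And>i j. i < 2 * k \<Longrightarrow> j < 2 * k \<Longrightarrow> i \<noteq> j \<Longrightarrow> A i ** A j = - (A j ** A i)"
  shows "\<exists>U. vec.subspace U \<and> U \<subseteq> V \<and> vec.dim V = 2 ^ k * vec.dim U \<and>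
    (\<forall>B. (\<forall>i<2*k. B ** A i = A i ** B) \<longrightarrow> (\<forall>v\<in>V. B *v v \<in> V) \<longrightarrow> (\<forall>v\<in>U. B *v v \<in> U))"
  using assms
proof (induction k arbitrary: A V)
  case 0
  show ?case using "0.prems"(1) by (intro exI[of _ V]) simp
next
  case (Suc k)
  obtain c d where c: "c \<noteq> 0" "A 0 ** A 0 = mat c" and d: "d \<noteq> 0" "A 1 ** A 1 = mat d"
    using Suc.prems(3)[of 0] Suc.prems(3)[of 1] by auto
  \<comment> \<open>The square c can be negative, as happens for the products \<open>A'\<close> when
    all squares are 1; hence complex scalars.\<close>
  define s where "s = csqrt c"
  have s: "s \<noteq> 0" "A 0 ** A 0 = mat (s\<^sup>2)"
    using c by (simp_all add: s_def)
  define W where "W = {v \<in> V. A 0 *v v = s *s v}"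
  define A' where "A' i = A 1 ** A (i + 2)" for i
  have W: "vec.subspace W"
    using Suc.prems(1) by (auto simp: W_def vec.subspace_def vec.add vec.scale vector_add_ldistrib mult_ac)
  have commute_W: "B *v v \<in> W" if "B ** A 0 = A 0 ** B" "\<And>v. v \<in> V \<Longrightarrow> B *v v \<in> V" "v \<in> W" for B v
  proof -
    have "A 0 *v (B *v v) = B *v (A 0 *v v)"
      by (simp add: matrix_vector_mul_assoc that(1))
    then show ?thesis using that(2,3) by (simp add: W_def vec.scale)
  qed
  have dimV: "vec.dim V = 2 * vec.dim W"
    unfolding W_def using Suc.prems(4)[of 0 1]
    by (intro eigenspace_halving[OF Suc.prems(1) Suc.prems(2) Suc.prems(2) s(2) d(2) s(1) d(1)]) auto
  \<comment> \<open>Exchanging \<open>A (i + 2)\<close> with \<open>A 1\<close> costs a sign and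
    leaves the scalar \<open>A 1 ** A 1\<close>, so the \<open>A'\<close> inherit anticommutation
    from the \<open>A (i + 2)\<close>.\<close>
  have prod: "A' i ** A' j = - (A 1 ** A 1) ** (A (i + 2) ** A (j + 2))"
    if "i < 2 * k" "j < 2 * k" for i j
  proof -
    have "A' i ** A' j = A 1 ** (A (i + 2) ** A 1) ** A (j + 2)"
      by (simp add: A'_def matrix_mul_assoc)
    also have "\<dots> = - (A 1 ** A 1) ** (A (i + 2) ** A (j + 2))"
      using that by (subst Suc.prems(4)) (auto simp: matrix_mult_uminus matrix_mul_assoc)
    finally show ?thesis .
  qed
  have "\<exists>U. vec.subspace U \<and> U \<subseteq> W \<and> vec.dim W = 2 ^ k * vec.dim U \<and>
    (\<forall>B. (\<forall>i<2*k. B ** A' i = A' i ** B) \<longrightarrow> (\<forall>v\<in>W. B *v v \<in> W) \<longrightarrow> (\<forall>v\<in>U. B *v v \<in> U))"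
  proof (rule Suc.IH)
    show "vec.subspace W" by (rule W)
    fix i assume i: "i < 2 * k"
    \<comment> \<open>Moving \<open>A 0\<close> past two anticommuting factors costs two signs, so
      \<open>A' i\<close> commutes with it and preserves its eigenspace.\<close>
    have "A' i ** A 0 = A 0 ** A' i"
    proof -
      have "A' i ** A 0 = A 1 ** (A (i + 2) ** A 0)"
        by (simp add: A'_def matrix_mul_assoc)
      also have "\<dots> = - (A 1 ** A 0) ** A (i + 2)"
        using i by (subst Suc.prems(4)) (auto simp: matrix_mult_uminus matrix_mul_assoc)
      also have "\<dots> = A 0 ** A' i"
        using i by (subst Suc.prems(4)) (auto simp: matrix_mult_uminus matrix_mul_assoc A'_def)
      finally show ?thesis .
    qed
    moreover have "A' i *v v \<in> V" if "v \<in> V" for v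
      using i that Suc.prems(2) by (simp add: A'_def flip: matrix_vector_mul_assoc)
    ultimately show "A' i *v v \<in> W" if "v \<in> W" for v
      using commute_W that by blast
    obtain e where e: "e \<noteq> 0" "A (i + 2) ** A (i + 2) = mat e"
      using Suc.prems(3)[of "i + 2"] i by auto
    have "A' i ** A' i = mat (- (d * e))"
      using prod[OF i i] e d by (simp add: mat_mult_mat matrix_mult_uminus) (simp add: mat_def vec_eq_iff)
    then show "\<exists>c. c \<noteq> 0 \<and> A' i ** A' i = mat c"
      using e d by (intro exI[of _ "- (d * e)"]) auto
  next
    fix i j assume ij: "i < 2 * k" "j < 2 * k" "i \<noteq> j"
    have "A' i ** A' j = - (A 1 ** A 1) ** (A (i + 2) ** A (j + 2))"
      by (rule prod) fact+
    also have "A (i + 2) ** A (j + 2) = - (A (j + 2) ** A (i + 2))"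
      using ij by (intro Suc.prems(4)) auto
    also have "- (A 1 ** A 1) ** - (A (j + 2) ** A (i + 2)) = - (A' j ** A' i)"
      by (simp add: prod ij matrix_mult_uminus)
    finally show "A' i ** A' j = - (A' j ** A' i)" .
  qed
  then obtain U where U: "vec.subspace U" "U \<subseteq> W" "vec.dim W = 2 ^ k * vec.dim U"
    "\<And>B. \<forall>i<2*k. B ** A' i = A' i ** B \<Longrightarrow> \<forall>v\<in>W. B *v v \<in> W \<Longrightarrow> \<forall>v\<in>U. B *v v \<in> U"
    by blast
  show ?case
  proof (intro exI[of _ U] conjI allI impI)
    show "U \<subseteq> V" using U(2) by (auto simp: W_def)
    show "vec.dim V = 2 ^ Suc k * vec.dim U" using dimV U(3) by simp
    fix B assume B: "\<forall>i<2 * Suc k. B ** A i = A i ** B" "\<forall>v\<in>V. B *v v \<in> V"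
    show "\<forall>v\<in>U. B *v v \<in> U"
    proof (rule U(4))
      show "\<forall>i<2 * k. B ** A' i = A' i ** B"
      proof (intro allI impI)
        fix i assume i: "i < 2 * k"
        have "B ** A' i = (B ** A 1) ** A (i + 2)" by (simp add: A'_def matrix_mul_assoc)
        also have "B ** A 1 = A 1 ** B" using B(1) by auto
        also have "A 1 ** B ** A (i + 2) = A 1 ** (B ** A (i + 2))" by (simp add: matrix_mul_assoc)
        also have "B ** A (i + 2) = A (i + 2) ** B" using B(1) i by auto
        finally show "B ** A' i = A' i ** B" by (simp add: A'_def matrix_mul_assoc)
      qed
      show "\<forall>v\<in>W. B *v v \<in> W"
        using commute_W[of B] B by auto
    qed
  qed (rule U(1))
qed

text \<open>An even number of generators of the first factor cuts out a subspace U by p div 2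
  halvings. The generators of the second factor commute with them, hence preserve U and allow q div
  2 further halvings inside U.\<close>

lemma clifford_system_dvd_complex:
  fixes S :: "nat \<Rightarrow> complex^'m^'m"
  assumes "clifford_system p q S"
  shows "2 ^ (p div 2 + q div 2) dvd CARD('m)"
proof -
  interpret clifford_system p q S by fact
  let ?k = "p div 2" and ?l = "q div 2"
  have sq: "\<exists>c. c \<noteq> 0 \<and> S i ** S i = mat c" if "i \<in> {1..p+q}" for i
    using square[OF that] by (intro exI[of _ 1]) auto
  have "\<exists>U. vec.subspace U \<and> U \<subseteq> UNIV \<and> vec.dim (UNIV :: (complex^'m) set) = 2 ^ ?k * vec.dim U \<and>
    (\<forall>B. (\<forall>i<2*?k. B ** S (Suc i) = S (Suc i) ** B) \<longrightarrow> (\<forall>v\<in>UNIV. B *v v \<in> UNIV) \<longrightarrow> (\<forall>v\<in>U. B *v v \<in> U))"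
    by (rule anticommuting_family_halving) (auto intro!: sq anticommute)
  then obtain U where U: "vec.subspace U" "CARD('m) = 2 ^ ?k * vec.dim U"
    "\<And>B v. \<forall>i<2*?k. B ** S (Suc i) = S (Suc i) ** B \<Longrightarrow> v \<in> U \<Longrightarrow> B *v v \<in> U"
    unfolding vec_dim_card by auto
  have "\<exists>U'. vec.subspace U' \<and> U' \<subseteq> U \<and> vec.dim U = 2 ^ ?l * vec.dim U' \<and>
    (\<forall>B. (\<forall>i<2*?l. B ** S (p + Suc i) = S (p + Suc i) ** B) \<longrightarrow> (\<forall>v\<in>U. B *v v \<in> U) \<longrightarrow> (\<forall>v\<in>U'. B *v v \<in> U'))"
    by (rule anticommuting_family_halving) (auto intro!: U sq anticommute commute)
  then obtain U' :: "(complex^'m) set" where "vec.dim U = 2 ^ ?l * vec.dim U'"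
    by blast
  then show ?thesis using U(2) by (simp add: power_add)
qed

section \<open>Expansion of the quartic along lines\<close>

lemma scalar_product_parseval:
  fixes u v :: "'a::comm_ring_1^'n"
  shows "(\<Sum>a\<in>UNIV. scalar_product u (axis a 1) * scalar_product v (axis a 1)) = scalar_product u v"
  by (simp add: scalar_product_commute[of _ "axis _ 1"] scalar_product_axis) (simp add: scalar_product_def)

lemma matrix_vector_mult_axis: "(A *v axis a 1) $ b = A $ b $ a"
  for A :: "'a::comm_ring_1^'n^'k"
  by (simp add: matrix_vector_mult_def axis_def if_distrib[where f = "\<lambda>x. _ * x"] cong: if_cong)

lemma trace_scalar_product:
  fixes A B :: "'a::comm_ring_1^'n^'n"
  shows "(\<Sum>a\<in>UNIV. scalar_product (A *v axis a 1) (B *v axis a 1)) = trace (transpose A ** B)"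
  by (simp add: scalar_product_def trace_def matrix_matrix_mult_def transpose_def
      matrix_vector_mult_axis)
  
text \<open>Conjugation by the involution K preserves the trace and sends A to -A.\<close>

lemma trace_eq_0_if_anticommutes:
  fixes A K :: "'a::field_char_0^'n^'n"
  assumes "K ** K = mat 1" "K ** A = - (A ** K)"
  shows "trace A = 0"
proof -
  have "trace A = trace (K ** (K ** A))"
    by (simp add: matrix_mul_assoc assms(1))
  also have "\<dots> = trace ((K ** A) ** K)"
    by (rule trace_mul_sym)
  also have "(K ** A) ** K = - A"
    by (simp add: assms matrix_mult_uminus flip: matrix_mul_assoc)
  also have "trace (- A) = - trace A"
    by (simp add: trace_def sum_negf)
  finally show ?thesis by simp
qed

context clifford_system
begin

lemma quad_val_line:
  assumes "i \<in> {1..p+q}"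
  shows "quad_val (S i) (w + t *s h) =
    quad_val (S i) w + 2 * t * scalar_product (S i *v w) h + t\<^sup>2 * quad_val (S i) h"
proof -
  have "scalar_product h (S i *v w) = scalar_product (S i *v w) h"
    "scalar_product w (S i *v h) = scalar_product (S i *v w) h"
    using assms by (simp_all add: self_adjoint scalar_product_commute[of h])
  then show ?thesis
    by (simp add: quad_val_scalar_product vec.add vec.scale scalar_product_add scalar_product_add_left
        scalar_product_scale algebra_simps power2_eq_square)
qed

text \<open>The coefficient of t is the derivative at w in direction h and that of t^2 is half the
  second derivative. The coefficient of t^3 is the first one with w and h exchanged.\<close>

lemma clifford_quartic_line:
  "clifford_quartic p q S (w + t *s h) = clifford_quartic p q S w
    + 4 * t * (\<Sum>i\<in>{1..p+q}. \<epsilon> i * quad_val (S i) w * scalar_product (S i *v w) h)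
    + t\<^sup>2 * (\<Sum>i\<in>{1..p+q}. \<epsilon> i *
        (4 * (scalar_product (S i *v w) h)\<^sup>2 + 2 * quad_val (S i) w * quad_val (S i) h))
    + 4 * t ^ 3 * (\<Sum>i\<in>{1..p+q}. \<epsilon> i * quad_val (S i) h * scalar_product (S i *v h) w)
    + t ^ 4 * clifford_quartic p q S h"
  unfolding clifford_quartic_alt sum_distrib_left sum.distrib[symmetric]
proof (rule sum.cong[OF refl])
  fix i assume i: "i \<in> {1..p+q}"
  have "scalar_product (S i *v h) w = scalar_product (S i *v w) h"
    using i by (metis self_adjoint scalar_product_commute)
  then show "\<epsilon> i * (quad_val (S i) (w + t *s h))\<^sup>2 = \<epsilon> i * (quad_val (S i) w)\<^sup>2
      + 4 * t * (\<epsilon> i * quad_val (S i) w * scalar_product (S i *v w) h)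
      + t\<^sup>2 * (\<epsilon> i * (4 * (scalar_product (S i *v w) h)\<^sup>2 + 2 * quad_val (S i) w * quad_val (S i) h))
      + 4 * t ^ 3 * (\<epsilon> i * quad_val (S i) h * scalar_product (S i *v h) w)
      + t ^ 4 * (\<epsilon> i * (quad_val (S i) h)\<^sup>2)"
    by (simp add: quad_val_line[OF i] algebra_simps power2_eq_square power3_eq_cube power4_eq_xxxx)
qed

lemma
  assumes "\<And>w. clifford_quartic p q S w = 0"
  shows quartic_zero_gradient:
      "(\<Sum>i\<in>{1..p+q}. \<epsilon> i * quad_val (S i) w * scalar_product (S i *v w) h) = 0"
    and quartic_zero_hessian:
      "(\<Sum>i\<in>{1..p+q}. \<epsilon> i *
        (4 * (scalar_product (S i *v w) h)\<^sup>2 + 2 * quad_val (S i) w * quad_val (S i) h)) = 0"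
proof -
  define c1 where "c1 = (\<Sum>i\<in>{1..p+q}. \<epsilon> i * quad_val (S i) w * scalar_product (S i *v w) h)"
  define c2 where "c2 = (\<Sum>i\<in>{1..p+q}. \<epsilon> i *
        (4 * (scalar_product (S i *v w) h)\<^sup>2 + 2 * quad_val (S i) w * quad_val (S i) h))"
  define c3 where "c3 = (\<Sum>i\<in>{1..p+q}. \<epsilon> i * quad_val (S i) h * scalar_product (S i *v h) w)"
  have t: "4 * t * c1 + t\<^sup>2 * c2 + 4 * t ^ 3 * c3 = 0" for t
    using clifford_quartic_line[of w t h] unfolding c1_def[symmetric] c2_def[symmetric] c3_def[symmetric]
    by (simp add: assms)
  \<comment> \<open>The values at t = 1 and t = -1 add up to \<open>2 * c2\<close>. Below, eight
    times the value at 1 minus the value at 2 cancels \<open>c3\<close> and leaves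
    \<open>c1\<close>.\<close>
  have "2 * c2 = (4 * 1 * c1 + 1\<^sup>2 * c2 + 4 * 1 ^ 3 * c3) + (4 * (-1) * c1 + (-1)\<^sup>2 * c2 + 4 * (-1) ^ 3 * c3)"
    by simp
  then show "c2 = 0" unfolding t by simp
  have "24 * c1 = 8 * (4 * 1 * c1 + 1\<^sup>2 * c2 + 4 * 1 ^ 3 * c3) - (4 * 2 * c1 + 2\<^sup>2 * c2 + 4 * 2 ^ 3 * c3) - 4 * c2"
    by simp
  then show "c1 = 0" unfolding t using \<open>c2 = 0\<close> by simp
qed

section \<open>Vanishing traces and the trace of the Hessian\<close>

lemma trace_eq_0:
  assumes "i \<in> {1..p+q}" "k \<in> {1..p+q}" "i \<noteq> k" "i \<le> p \<longleftrightarrow> k \<le> p"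
  shows "trace (S i) = 0"
  using assms by (intro trace_eq_0_if_anticommutes[of "S k"] square anticommute) auto

text \<open>Within one factor, \<open>S i\<close> itself anticommutes with
  \<open>S i ** S j\<close>. Across the factors this is done by a further generator
  \<open>S k\<close> of the first factor, which anticommutes with one matrix and commutes with the
  other.\<close>

lemma trace_mult_eq_0:
  assumes "q \<le> p" "(p, q) \<noteq> (1, 1)" "i \<in> {1..p+q}" "j \<in> {1..p+q}" "i \<noteq> j"
  shows "trace (S i ** S j) = 0"
proof (cases "i \<le> p \<longleftrightarrow> j \<le> p")
  case True
  have "S i ** (S i ** S j) = - ((S i ** S j) ** S i)"
  proof -
    have "(S i ** S j) ** S i = - (S j ** S i) ** S i"
      using anticommute[of i j] assms True by simp
    also have "\<dots> = - S j"
      using assms by (simp add: matrix_mult_uminus square flip: matrix_mul_assoc)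
    finally show ?thesis using assms by (simp add: matrix_mul_assoc square)
  qed
  then show ?thesis
    using assms by (intro trace_eq_0_if_anticommutes[of "S i"] square) auto
next
  case False
  have *: "trace (S a ** S b) = 0"
    if ab: "a \<in> {1..p}" "b \<in> {p+1..p+q}" for a b
  proof -
    \<comment> \<open>The index b gives 1 \<le> q, so p = 1 would mean (p, q) = (1, 1).\<close>
    have "2 \<le> p" using ab assms(1,2) by (cases "p = 1") auto
    then obtain k where k: "k \<in> {1..p}" "k \<noteq> a"
      by (metis One_nat_def Suc_1 Suc_leD atLeastAtMost_iff le_refl n_not_Suc_n)
    have 1: "S k ** S a = - (S a ** S k)" "S k ** S b = S b ** S k"
      using ab k by (auto intro!: anticommute commute)
    have "S k ** (S a ** S b) = - (S a ** S k) ** S b"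
      by (simp add: matrix_mul_assoc 1)
    also have "\<dots> = - (S a ** (S k ** S b))"
      by (simp add: matrix_mult_uminus matrix_mul_assoc)
    finally have "S k ** (S a ** S b) = - ((S a ** S b) ** S k)"
      by (simp add: 1 matrix_mul_assoc)
    then show ?thesis
      using k by (intro trace_eq_0_if_anticommutes[of "S k"] square) auto
  qed
  show ?thesis
  proof (cases "i \<le> p")
    case True
    then show ?thesis using False assms by (intro *) auto
  next
    case i: False
    then show ?thesis using False assms by (subst trace_mul_sym, intro *) auto
  qed
qed

text \<open>Every \<open>S i\<close> has an anticommuting partner in its own factor, so all traces
  vanish. The trace of the vanishing Hessian form at a unit vector is then 4 * (p - q).\<close>

lemma quartic_zero_imp_eq:
  assumes zero: "\<And>w. clifford_quartic p q S w = 0" and "2 \<le> p" "q \<noteq> 1"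
  shows "p = q"
proof -
  \<comment> \<open>An arbitrary standard basis vector; only its unit length matters.\<close>
  define w :: "'a^'m" where "w = axis undefined 1"
  have tr: "trace (S i) = 0" if i: "i \<in> {1..p+q}" for i
  proof -
    obtain k where "k \<in> {1..p+q}" "k \<noteq> i" "i \<le> p \<longleftrightarrow> k \<le> p"
    proof (cases "i \<le> p")
      case True
      then show thesis using that[of 1] that[of 2] assms(2) by (cases "i = 1") auto
    next
      case False
      then show thesis using that[of "p+1"] that[of "p+2"] assms(3) i by (cases "i = p + 1") auto
    qed
    then show ?thesis using trace_eq_0[of i k] i by auto
  qed
  have quad_tr: "(\<Sum>a\<in>UNIV. quad_val (S i) (axis a 1)) = trace (S i)" for i
    by (simp add: quad_val_scalar_product scalar_product_axis trace_def matrix_vector_mult_axis)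
  have norm: "(\<Sum>a\<in>UNIV. (scalar_product (S i *v w) (axis a 1))\<^sup>2) = 1" if "i \<in> {1..p+q}" for i
    using that unfolding power2_eq_square scalar_product_parseval
    by (simp add: isometry) (simp add: w_def scalar_product_axis)
  have "0 = (\<Sum>a\<in>UNIV. \<Sum>i\<in>{1..p+q}. \<epsilon> i * (4 * (scalar_product (S i *v w) (axis a 1))\<^sup>2
      + 2 * quad_val (S i) w * quad_val (S i) (axis a 1)))"
    by (simp only: quartic_zero_hessian[OF zero] sum.neutral_const)
  also have "\<dots> = (\<Sum>i\<in>{1..p+q}. \<epsilon> i * (4 * (\<Sum>a\<in>UNIV. (scalar_product (S i *v w) (axis a 1))\<^sup>2)
      + 2 * quad_val (S i) w * (\<Sum>a\<in>UNIV. quad_val (S i) (axis a 1))))"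
    by (subst sum.swap) (simp add: sum_distrib_left sum.distrib distrib_left)
  also have "\<dots> = (\<Sum>i\<in>{1..p+q}. \<epsilon> i * 4)"
    by (rule sum.cong) (simp_all only: norm quad_tr tr, simp_all)
  also have "\<dots> = 4 * of_nat p - 4 * of_nat q"
    unfolding sum_split_sig by (simp add: sig_sign_def)
  finally have "(of_nat p :: 'a) = of_nat q" by simp
  then show ?thesis by simp
qed

lemma trace_square: "i \<in> {1..p+q} \<Longrightarrow> trace (S i ** S i) = of_nat CARD('m)"
  by (simp only: square trace_I)

end

section \<open>The norm of the symmetrized quartic\<close>

lemma sum_swap_middle: "(\<Sum>a\<in>UNIV. \<Sum>b\<in>UNIV. \<Sum>c\<in>UNIV. \<Sum>d\<in>UNIV. f a c b d) =
    (\<Sum>a\<in>UNIV. \<Sum>b\<in>UNIV. \<Sum>c\<in>UNIV. \<Sum>d\<in>UNIV. f a b c d)"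
  for f :: "'x::finite \<Rightarrow> 'x \<Rightarrow> 'x \<Rightarrow> 'x \<Rightarrow> 'b::comm_monoid_add"
  by (rule sum.cong[OF refl], rule sum.swap)

lemma sum_swap_last: "(\<Sum>a\<in>UNIV. \<Sum>b\<in>UNIV. \<Sum>c\<in>UNIV. \<Sum>d\<in>UNIV. f a b d c) =
    (\<Sum>a\<in>UNIV. \<Sum>b\<in>UNIV. \<Sum>c\<in>UNIV. \<Sum>d\<in>UNIV. f a b c d)"
  for f :: "'x::finite \<Rightarrow> 'x \<Rightarrow> 'x \<Rightarrow> 'x \<Rightarrow> 'b::comm_monoid_add"
  by (rule sum.cong[OF refl], rule sum.cong[OF refl], rule sum.swap)

context clifford_system
begin

text \<open>A coefficient tensor of the quartic. It is symmetric within each index pair but in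
  general not totally symmetric; adding the three pairings of four indices symmetrizes it.\<close>

definition quartic_tensor :: "'m \<Rightarrow> 'm \<Rightarrow> 'm \<Rightarrow> 'm \<Rightarrow> 'a" where
  "quartic_tensor a b c d = (\<Sum>i\<in>{1..p+q}. \<epsilon> i * S i $ a $ b * S i $ c $ d)"

lemma symmetric_nth: "i \<in> {1..p+q} \<Longrightarrow> S i $ a $ b = S i $ b $ a"
  using symmetric[of i] by (metis (no_types, lifting) transpose_def vec_lambda_beta)

lemma quartic_tensor_sym:
  "quartic_tensor b a c d = quartic_tensor a b c d"
  "quartic_tensor a b d c = quartic_tensor a b c d"
  unfolding quartic_tensor_def by (rule sum.cong; simp add: symmetric_nth)+

lemma clifford_quartic_tensor:
  "clifford_quartic p q S w = (\<Sum>a\<in>UNIV. \<Sum>b\<in>UNIV. \<Sum>c\<in>UNIV. \<Sum>d\<in>UNIV.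
    quartic_tensor a b c d * (w $ a * w $ b * w $ c * w $ d))"
proof -
  have "(quad_val (S i) w)\<^sup>2 = (\<Sum>a\<in>UNIV. \<Sum>b\<in>UNIV. \<Sum>c\<in>UNIV. \<Sum>d\<in>UNIV.
      S i $ a $ b * S i $ c $ d * (w $ a * w $ b * w $ c * w $ d))" for i
    unfolding power2_eq_square quad_val_def matrix_vector_mult_def vec_lambda_beta
      sum_distrib_left sum_distrib_right
    by (subst sum.swap, rule sum.cong[OF refl], subst sum.swap) (simp add: mult_ac sum_distrib_left)
  then have "clifford_quartic p q S w = (\<Sum>i\<in>{1..p+q}. \<Sum>a\<in>UNIV. \<Sum>b\<in>UNIV. \<Sum>c\<in>UNIV. \<Sum>d\<in>UNIV.
      \<epsilon> i * S i $ a $ b * S i $ c $ d * (w $ a * w $ b * w $ c * w $ d))"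
    by (simp add: clifford_quartic_alt sum_distrib_left mult.assoc)
  also have "\<dots> = (\<Sum>a\<in>UNIV. \<Sum>b\<in>UNIV. \<Sum>c\<in>UNIV. \<Sum>d\<in>UNIV. \<Sum>i\<in>{1..p+q}.
      \<epsilon> i * S i $ a $ b * S i $ c $ d * (w $ a * w $ b * w $ c * w $ d))"
    by (subst sum.swap, rule sum.cong[OF refl], subst sum.swap, rule sum.cong[OF refl],
        subst sum.swap, rule sum.cong[OF refl], rule sum.swap)
  finally show ?thesis
    by (simp add: quartic_tensor_def sum_distrib_right)
qed

lemma sum_tensor_pair:
  "(\<Sum>a\<in>UNIV. \<Sum>b\<in>UNIV. \<Sum>c\<in>UNIV. \<Sum>d\<in>UNIV. quartic_tensor a b c d * f a b c d) =
   (\<Sum>i\<in>{1..p+q}. \<epsilon> i * (\<Sum>a\<in>UNIV. \<Sum>b\<in>UNIV. \<Sum>c\<in>UNIV. \<Sum>d\<in>UNIV. S i $ a $ b * S i $ c $ d * f a b c d))"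
proof -
  have "(\<Sum>a\<in>UNIV. \<Sum>b\<in>UNIV. \<Sum>c\<in>UNIV. \<Sum>d\<in>UNIV. quartic_tensor a b c d * f a b c d) =
    (\<Sum>a\<in>UNIV. \<Sum>b\<in>UNIV. \<Sum>c\<in>UNIV. \<Sum>d\<in>UNIV. \<Sum>i\<in>{1..p+q}. \<epsilon> i * (S i $ a $ b * S i $ c $ d * f a b c d))"
    by (simp add: quartic_tensor_def sum_distrib_right mult.assoc)
  also have "\<dots> = (\<Sum>i\<in>{1..p+q}. \<Sum>a\<in>UNIV. \<Sum>b\<in>UNIV. \<Sum>c\<in>UNIV. \<Sum>d\<in>UNIV.
      \<epsilon> i * (S i $ a $ b * S i $ c $ d * f a b c d))"
    by (subst (2) sum.swap, rule sum.cong[OF refl], subst (2) sum.swap, rule sum.cong[OF refl],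
        subst (2) sum.swap, rule sum.cong[OF refl], rule sum.swap)
  finally show ?thesis by (simp add: sum_distrib_left)
qed

lemma trace_mult_eq_sum:
  assumes "j \<in> {1..p+q}"
  shows "trace (S i ** S j) = (\<Sum>a\<in>UNIV. \<Sum>b\<in>UNIV. S i $ a $ b * S j $ a $ b)"
  using assms by (simp add: trace_def matrix_matrix_mult_def symmetric_nth[of j])

section \<open>Contractions of the tensor as traces\<close>

lemma trace_tensor_square:
  assumes "i \<in> {1..p+q}" "j \<in> {1..p+q}"
  shows "(\<Sum>a\<in>UNIV. \<Sum>b\<in>UNIV. \<Sum>c\<in>UNIV. \<Sum>d\<in>UNIV.
    (S i $ a $ b * S i $ c $ d) * (S j $ a $ b * S j $ c $ d)) = (trace (S i ** S j))\<^sup>2"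
  unfolding power2_eq_square trace_mult_eq_sum[OF assms(2)] sum_distrib_left sum_distrib_right
  by (subst sum.swap, rule sum.cong[OF refl]) (subst sum.swap, simp add: mult_ac)

text \<open>With the indices paired crosswise, the four factors close up to a single cycle a, b, d,
  c, which gives one trace of a fourfold product instead of a square of traces.\<close>

lemma trace_tensor_cross:
  assumes "i \<in> {1..p+q}" "j \<in> {1..p+q}"
  shows "(\<Sum>a\<in>UNIV. \<Sum>b\<in>UNIV. \<Sum>c\<in>UNIV. \<Sum>d\<in>UNIV.
    (S i $ a $ b * S i $ c $ d) * (S j $ a $ c * S j $ b $ d)) = trace ((S i ** S j) ** (S i ** S j))"
proof -
  have "trace ((S i ** S j) ** (S i ** S j)) = (\<Sum>a\<in>UNIV. \<Sum>d\<in>UNIV. \<Sum>b\<in>UNIV. \<Sum>c\<in>UNIV.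
      (S i $ a $ b * S j $ b $ d) * (S i $ d $ c * S j $ c $ a))"
    by (simp add: trace_def matrix_matrix_mult_def sum_product)
  also have "\<dots> = (\<Sum>a\<in>UNIV. \<Sum>b\<in>UNIV. \<Sum>d\<in>UNIV. \<Sum>c\<in>UNIV.
      (S i $ a $ b * S j $ b $ d) * (S i $ d $ c * S j $ c $ a))"
    by (rule sum_swap_middle[symmetric])
  also have "\<dots> = (\<Sum>a\<in>UNIV. \<Sum>b\<in>UNIV. \<Sum>c\<in>UNIV. \<Sum>d\<in>UNIV.
      (S i $ a $ b * S j $ b $ d) * (S i $ d $ c * S j $ c $ a))"
    by (rule sum_swap_last[symmetric])
  also have "\<dots> = (\<Sum>a\<in>UNIV. \<Sum>b\<in>UNIV. \<Sum>c\<in>UNIV. \<Sum>d\<in>UNIV.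
    (S i $ a $ b * S i $ c $ d) * (S j $ a $ c * S j $ b $ d))"
    using assms by (intro sum.cong refl) (simp add: symmetric_nth[of i _ "_ :: 'm"] symmetric_nth[of j] mult_ac)
  finally show ?thesis by simp
qed

lemma trace_product_square:
  assumes "i \<in> {1..p+q}" "j \<in> {1..p+q}" "i \<noteq> j"
  shows "trace ((S i ** S j) ** (S i ** S j)) = - (\<epsilon> i * \<epsilon> j * of_nat CARD('m))"
proof -
  have "(S i ** S j) ** (S i ** S j) = mat (- (\<epsilon> i * \<epsilon> j))"
    using assms
    by (simp add: matrix_eq mat_vector_mult swap_vec[of i j] vec.scale vec.neg square_vec
        flip: matrix_vector_mul_assoc) 
  then show ?thesis by (simp add: trace_def mat_def)
qed

lemma tensor_norm_self:
  assumes "\<And>i j. i \<in> {1..p+q} \<Longrightarrow> j \<in> {1..p+q} \<Longrightarrow> i \<noteq> j \<Longrightarrow> trace (S i ** S j) = 0"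
  shows "(\<Sum>a\<in>UNIV. \<Sum>b\<in>UNIV. \<Sum>c\<in>UNIV. \<Sum>d\<in>UNIV. quartic_tensor a b c d * quartic_tensor a b c d) =
    of_nat (p + q) * of_nat CARD('m) ^ 2"
proof -
  have "(\<Sum>a\<in>UNIV. \<Sum>b\<in>UNIV. \<Sum>c\<in>UNIV. \<Sum>d\<in>UNIV. S i $ a $ b * S i $ c $ d * quartic_tensor a b c d) =
      \<epsilon> i * of_nat CARD('m) ^ 2" if i: "i \<in> {1..p+q}" for i
  proof -
    have "(\<Sum>a\<in>UNIV. \<Sum>b\<in>UNIV. \<Sum>c\<in>UNIV. \<Sum>d\<in>UNIV. S i $ a $ b * S i $ c $ d * quartic_tensor a b c d) =
      (\<Sum>j\<in>{1..p+q}. \<epsilon> j * (trace (S j ** S i))\<^sup>2)"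
      unfolding mult.commute[of _ "quartic_tensor _ _ _ _"] sum_tensor_pair
      by (intro sum.cong refl) (simp only: trace_tensor_square[OF _ i])
    also have "\<dots> = (\<Sum>j\<in>{i}. \<epsilon> j * (trace (S j ** S i))\<^sup>2)"
      using i assms by (intro sum.mono_neutral_right) auto
    finally show ?thesis using i by (simp add: trace_square)
  qed
  then show ?thesis
    unfolding sum_tensor_pair by simp
qed

lemma tensor_norm_cross:
  "(\<Sum>a\<in>UNIV. \<Sum>b\<in>UNIV. \<Sum>c\<in>UNIV. \<Sum>d\<in>UNIV. quartic_tensor a b c d * quartic_tensor a c b d) =
    of_nat (p + q) * of_nat CARD('m) * (2 - of_nat (p + q))"
proof -
  have "(\<Sum>a\<in>UNIV. \<Sum>b\<in>UNIV. \<Sum>c\<in>UNIV. \<Sum>d\<in>UNIV. S i $ a $ b * S i $ c $ d * quartic_tensor a c b d) =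
      \<epsilon> i * of_nat CARD('m) * (2 - of_nat (p + q))" if i: "i \<in> {1..p+q}" for i
  proof -
    have "(\<Sum>a\<in>UNIV. \<Sum>b\<in>UNIV. \<Sum>c\<in>UNIV. \<Sum>d\<in>UNIV. S i $ a $ b * S i $ c $ d * quartic_tensor a c b d) =
      (\<Sum>a\<in>UNIV. \<Sum>b\<in>UNIV. \<Sum>c\<in>UNIV. \<Sum>d\<in>UNIV. S i $ a $ c * S i $ b $ d * quartic_tensor a b c d)"
      by (rule sum_swap_middle[symmetric])
    also have "\<dots> = (\<Sum>j\<in>{1..p+q}. \<epsilon> j * trace ((S j ** S i) ** (S j ** S i)))"
      unfolding mult.commute[of _ "quartic_tensor _ _ _ _"] sum_tensor_pair
      by (intro sum.cong refl) (simp only: trace_tensor_cross[OF _ i])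
    \<comment> \<open>Each j other than i contributes \<open>- \<epsilon> i\<close> times the
      dimension and j = i contributes the opposite, written as that constant plus a correction by
      2.\<close>
    also have "\<dots> = (\<Sum>j\<in>{1..p+q}. (if j = i then 2 * \<epsilon> i * of_nat CARD('m) else 0) - \<epsilon> i * of_nat CARD('m))"
      using i by (intro sum.cong refl) (auto simp: trace_product_square square trace_I mult_ac)
    also have "\<dots> = \<epsilon> i * of_nat CARD('m) * (2 - of_nat (p + q))"
      using i by (simp add: sum_subtractf algebra_simps)
    finally show ?thesis .
  qed
  then have "(\<Sum>a\<in>UNIV. \<Sum>b\<in>UNIV. \<Sum>c\<in>UNIV. \<Sum>d\<in>UNIV. quartic_tensor a b c d * quartic_tensor a c b d) =
      (\<Sum>i\<in>{1..p+q}. \<epsilon> i * (\<epsilon> i * of_nat CARD('m) * (2 - of_nat (p + q))))"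
    unfolding sum_tensor_pair by simp
  then show ?thesis by (simp add: mult.assoc)
qed

text \<open>Expanding the square gives three equal norms \<open>?X\<close> and six equal cross terms
  \<open>?Y\<close>. With n = p + q and m the dimension, they are n * m^2 and n * m * (2 -
  n).\<close>

lemma symmetrized_tensor_norm:
  assumes "\<And>i j. i \<in> {1..p+q} \<Longrightarrow> j \<in> {1..p+q} \<Longrightarrow> i \<noteq> j \<Longrightarrow> trace (S i ** S j) = 0"
  shows "(\<Sum>a\<in>UNIV. \<Sum>b\<in>UNIV. \<Sum>c\<in>UNIV. \<Sum>d\<in>UNIV.
      (quartic_tensor a b c d + quartic_tensor a c b d + quartic_tensor a d b c)\<^sup>2) =
    3 * of_nat (p + q) * of_nat CARD('m) * (of_nat CARD('m) + 4 - 2 * of_nat (p + q))"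
proof -
  let ?F = quartic_tensor
  let ?X = "\<Sum>a\<in>UNIV. \<Sum>b\<in>UNIV. \<Sum>c\<in>UNIV. \<Sum>d\<in>UNIV. ?F a b c d * ?F a b c d"
  let ?Y = "\<Sum>a\<in>UNIV. \<Sum>b\<in>UNIV. \<Sum>c\<in>UNIV. \<Sum>d\<in>UNIV. ?F a b c d * ?F a c b d"
  have 22: "(\<Sum>a\<in>UNIV. \<Sum>b\<in>UNIV. \<Sum>c\<in>UNIV. \<Sum>d\<in>UNIV. ?F a c b d * ?F a c b d) = ?X"
    by (rule sum_swap_middle)
  have 33: "(\<Sum>a\<in>UNIV. \<Sum>b\<in>UNIV. \<Sum>c\<in>UNIV. \<Sum>d\<in>UNIV. ?F a d b c * ?F a d b c) = ?X"
    using sum_swap_last[of "\<lambda>a b c d. ?F a c b d * ?F a c b d"] 22 by simp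
  have 13: "(\<Sum>a\<in>UNIV. \<Sum>b\<in>UNIV. \<Sum>c\<in>UNIV. \<Sum>d\<in>UNIV. ?F a b c d * ?F a d b c) = ?Y"
    using sum_swap_last[of "\<lambda>a b c d. ?F a b c d * ?F a c b d"] by (simp add: quartic_tensor_sym)
  have 23: "(\<Sum>a\<in>UNIV. \<Sum>b\<in>UNIV. \<Sum>c\<in>UNIV. \<Sum>d\<in>UNIV. ?F a c b d * ?F a d b c) = ?Y"
    using sum_swap_middle[of "\<lambda>a b c d. ?F a b c d * ?F a d c b"] 13
    by (simp add: quartic_tensor_sym(2)[of _ _ b c for b c])
  have "(\<Sum>a\<in>UNIV. \<Sum>b\<in>UNIV. \<Sum>c\<in>UNIV. \<Sum>d\<in>UNIV. (?F a b c d + ?F a c b d + ?F a d b c)\<^sup>2) =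
    (\<Sum>a\<in>UNIV. \<Sum>b\<in>UNIV. \<Sum>c\<in>UNIV. \<Sum>d\<in>UNIV.
      ?F a b c d * ?F a b c d + ?F a c b d * ?F a c b d + ?F a d b c * ?F a d b c
      + 2 * (?F a b c d * ?F a c b d) + 2 * (?F a b c d * ?F a d b c) + 2 * (?F a c b d * ?F a d b c))"
    by (intro sum.cong refl) (simp add: power2_eq_square algebra_simps)
  also have "\<dots> = 3 * ?X + 6 * ?Y"
    unfolding sum.distrib sum_distrib_left[symmetric] 22 33 13 23 by simp
  also have "?X = of_nat (p + q) * of_nat CARD('m) ^ 2"
    by (rule tensor_norm_self) (rule assms)
  also have "3 * (of_nat (p + q) * of_nat CARD('m) ^ 2) + 6 * ?Y =
      3 * of_nat (p + q) * of_nat CARD('m) * (of_nat CARD('m) + 4 - 2 * of_nat (p + q))"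
    unfolding tensor_norm_cross
    by (simp add: algebra_simps power2_eq_square)
  finally show ?thesis .
qed

text \<open>The monomial is symmetric in its indices, so each pairing reproduces the quartic
  once.\<close>

lemma symmetrized_tensor_quartic:
  "(\<Sum>a\<in>UNIV. \<Sum>b\<in>UNIV. \<Sum>c\<in>UNIV. \<Sum>d\<in>UNIV.
      (quartic_tensor a b c d + quartic_tensor a c b d + quartic_tensor a d b c)
      * (w $ a * w $ b * w $ c * w $ d)) = 3 * clifford_quartic p q S w"
proof -
  let ?F = quartic_tensor
  let ?W = "\<lambda>a b c d. w $ a * w $ b * w $ c * w $ d"
  have 2: "(\<Sum>a\<in>UNIV. \<Sum>b\<in>UNIV. \<Sum>c\<in>UNIV. \<Sum>d\<in>UNIV. ?F a c b d * ?W a b c d) = clifford_quartic p q S w"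
    using sum_swap_middle[of "\<lambda>a b c d. ?F a b c d * ?W a b c d"]
    by (simp add: clifford_quartic_tensor mult_ac)
  have 3: "(\<Sum>a\<in>UNIV. \<Sum>b\<in>UNIV. \<Sum>c\<in>UNIV. \<Sum>d\<in>UNIV. ?F a d b c * ?W a b c d) = clifford_quartic p q S w"
    using sum_swap_last[of "\<lambda>a b c d. ?F a c b d * ?W a b c d"] 2
    by (simp add: mult_ac)
  show ?thesis
    unfolding distrib_right sum.distrib 2 3
    by (simp flip: clifford_quartic_tensor)
qed

end

text \<open>The dimension equation makes the squared norm of the symmetrized tensor 0; over the
  reals all its entries vanish, and the quartic with them.\<close>

lemma quartic_zero_if_dimension:
  fixes S :: "nat \<Rightarrow> real^'m^'m"
  assumes "clifford_system p q S" "q \<le> p" "(p, q) \<noteq> (1, 1)" and m: "CARD('m) + 4 = 2 * (p + q)"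
  shows "clifford_quartic p q S w = 0"
proof -
  interpret clifford_system p q S by fact
  let ?G = "\<lambda>a b c d. quartic_tensor a b c d + quartic_tensor a c b d + quartic_tensor a d b c"
  have "real CARD('m) + 4 - 2 * real (p + q) = 0"
    using arg_cong[OF m, of real] by simp
  then have "(\<Sum>a\<in>UNIV. \<Sum>b\<in>UNIV. \<Sum>c\<in>UNIV. \<Sum>d\<in>UNIV. (?G a b c d)\<^sup>2) = 0"
    using symmetrized_tensor_norm[OF trace_mult_eq_0] assms(2,3) by simp
  then have "?G a b c d = 0" for a b c d
    by (simp add: sum_nonneg_eq_0_iff sum_nonneg)
  then show ?thesis
    using symmetrized_tensor_quartic[of w] by simp
qed

text \<open>Degeneracy concerns complex points. Writing z = x + iy and expanding along the line with
  parameter \<open>\<i>\<close>, every coefficient comes from a real identity satisfied by a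
  vanishing quartic, so the open set is empty.\<close>

lemma quartic_zero_imp_degenerate:
  fixes S :: "nat \<Rightarrow> real^'m^'m"
  assumes "clifford_system p q S" and zero: "\<And>w. clifford_quartic p q S w = 0"
  shows "degenerate p q S"
proof -
  interpret R: clifford_system p q S by fact
  interpret C: clifford_system p q "complexify S"
    by (rule clifford_system_complexify) fact
  let ?c = "\<lambda>v :: real^'m. (\<chi> a. complex_of_real (v $ a))"
  have q: "quad_val (complexify S i) (?c v) = of_real (quad_val (S i) v)" for i v
    by (simp add: quad_val_def matrix_vector_mult_def complexify_def)
  have b: "scalar_product (complexify S i *v ?c v) (?c h) = of_real (scalar_product (S i *v v) h)" for i v h
    by (simp add: scalar_product_def matrix_vector_mult_def complexify_def)
  have e: "sig_sign p i = complex_of_real (sig_sign p i)" for i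
    by (simp add: sig_sign_def)
  have quartic: "clifford_quartic p q (complexify S) (?c v) = 0" for v
  proof -
    have "clifford_quartic p q (complexify S) (?c v) = of_real (clifford_quartic p q S v)"
      by (simp add: clifford_quartic_alt q e)
    then show ?thesis by (simp add: zero)
  qed
  have gradient: "(\<Sum>i\<in>{1..p+q}. sig_sign p i * quad_val (complexify S i) (?c v) *
      scalar_product (complexify S i *v ?c v) (?c h)) = 0" for v h
    using arg_cong[OF R.quartic_zero_gradient[OF zero, of v h], of complex_of_real]
    by (simp add: q b e)
  have hessian: "(\<Sum>i\<in>{1..p+q}. sig_sign p i * (4 * (scalar_product (complexify S i *v ?c v) (?c h))\<^sup>2
      + 2 * quad_val (complexify S i) (?c v) * quad_val (complexify S i) (?c h))) = 0" for v h
    using arg_cong[OF R.quartic_zero_hessian[OF zero, of v h], of complex_of_real]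
    by (simp add: q b e)
  have "clifford_quartic p q (complexify S) z = 0" for z
  proof -
    have "z = ?c (\<chi> a. Re (z $ a)) + \<i> *s ?c (\<chi> a. Im (z $ a))"
      by (simp add: vec_eq_iff complex_eq_iff)
    then show ?thesis
      using C.clifford_quartic_line[of "?c (\<chi> a. Re (z $ a))" \<i> "?c (\<chi> a. Im (z $ a))"]
      unfolding gradient hessian quartic by simp
  qed
  then show ?thesis
    by (simp add: nondegenerate_def Let_def flip: clifford_quartic_def)
qed

section \<open>Cubic relations\<close>

context
  fixes p q :: nat and S :: "nat \<Rightarrow> real^'m^'m" and f :: "nat \<Rightarrow> real^'m \<Rightarrow> real"
  assumes S: "clifford_system p q S"
    and lin: "\<And>i. i \<in> {1..p+q} \<Longrightarrow> linear (f i)"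
    and cubic: "\<And>w. (\<Sum>i\<in>{1..p+q}. quad_val (S i) w * f i w) = 0"
begin

interpretation clifford_system p q S by (rule S)

definition form_vec :: "nat \<Rightarrow> real^'m" where
  "form_vec i = (\<chi> a. f i (axis a 1))"

lemma form_vec:
  assumes "i \<in> {1..p+q}"
  shows "f i w = scalar_product (form_vec i) w"
proof -
  have "f i w = f i (\<Sum>a\<in>UNIV. w $ a *s axis a 1)"
    by (simp only: basis_expansion)
  then show ?thesis
    by (simp add: linear_sum[OF lin[OF assms]] linear_cmul[OF lin[OF assms]] scalar_mult_eq_scaleR
        form_vec_def scalar_product_def mult.commute)
qed

lemma cubic_polarized:
  "(\<Sum>i\<in>{1..p+q}. scalar_product (S i *v u) v * f i w + scalar_product (S i *v v) w * f i u
    + scalar_product (S i *v w) u * f i v) = 0"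
proof -
  define C where "C w = (\<Sum>i\<in>{1..p+q}. quad_val (S i) w * f i w)" for w
  have add: "quad_val (S i) (x + y) = quad_val (S i) x + 2 * scalar_product (S i *v x) y + quad_val (S i) y"
    if "i \<in> {1..p+q}" for i x y
    using quad_val_line[OF that, of x 1 y] by simp
  \<comment> \<open>Inclusion-exclusion over the nonempty subsets of {u, v, w} extracts the
    trilinear part of the cubic form.\<close>
  have "C (u + v + w) - C (u + v) - C (v + w) - C (w + u) + C u + C v + C w =
    2 * (\<Sum>i\<in>{1..p+q}. scalar_product (S i *v u) v * f i w + scalar_product (S i *v v) w * f i u
      + scalar_product (S i *v w) u * f i v)"
    unfolding C_def sum_distrib_left sum.distrib[symmetric] sum_subtractf[symmetric]
  proof (rule sum.cong[OF refl])
    fix i assume i: "i \<in> {1..p+q}"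
    have "scalar_product (S i *v u) w = scalar_product (S i *v w) u"
      using i by (simp add: self_adjoint scalar_product_commute[of u])
    then show "quad_val (S i) (u + v + w) * f i (u + v + w) - quad_val (S i) (u + v) * f i (u + v)
      - quad_val (S i) (v + w) * f i (v + w) - quad_val (S i) (w + u) * f i (w + u)
      + quad_val (S i) u * f i u + quad_val (S i) v * f i v + quad_val (S i) w * f i w =
      2 * (scalar_product (S i *v u) v * f i w + scalar_product (S i *v v) w * f i u
      + scalar_product (S i *v w) u * f i v)"
      by (simp add: add[OF i] linear_add[OF lin[OF i]] scalar_product_add
          scalar_product_add_left vec.add algebra_simps)
  qed
  moreover have "C w = 0" for w
    unfolding C_def by (rule cubic)
  ultimately show ?thesis by simp
qed

text \<open>Put u = e and v = \<open>S j *v e\<close> in the polarized relation and sum over the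
  standard basis vectors e. The first term yields the trace, and the other two both yield
  \<open>S i *v (S j *v form_vec i)\<close>.\<close>

lemma cubic_contracted:
  assumes j: "j \<in> {1..p+q}"
  shows "(\<Sum>i\<in>{1..p+q}. trace (S i ** S j) *s form_vec i + 2 *s (S i *v (S j *v form_vec i))) = 0"
proof -
  have "scalar_product (\<Sum>i\<in>{1..p+q}. trace (S i ** S j) *s form_vec i + 2 *s (S i *v (S j *v form_vec i))) w = 0" for w
  proof -
    let ?e = "\<lambda>a. axis a 1 :: real^'m"
    have "0 = (\<Sum>a\<in>UNIV. \<Sum>i\<in>{1..p+q}. scalar_product (S i *v ?e a) (S j *v ?e a) * f i w
      + scalar_product (S i *v (S j *v ?e a)) w * f i (?e a)
      + scalar_product (S i *v w) (?e a) * f i (S j *v ?e a))"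
      by (simp only: cubic_polarized sum.neutral_const)
    also have "\<dots> = (\<Sum>i\<in>{1..p+q}. \<Sum>a\<in>UNIV. scalar_product (S i *v ?e a) (S j *v ?e a) * f i w
      + scalar_product (S i *v (S j *v ?e a)) w * f i (?e a)
      + scalar_product (S i *v w) (?e a) * f i (S j *v ?e a))"
      by (rule sum.swap)
    also have "\<dots> = (\<Sum>i\<in>{1..p+q}. trace (S i ** S j) * scalar_product (form_vec i) w
      + 2 * scalar_product (S i *v (S j *v form_vec i)) w)"
    proof (rule sum.cong[OF refl])
      fix i assume i: "i \<in> {1..p+q}"
      have 1: "(\<Sum>a\<in>UNIV. scalar_product (S i *v ?e a) (S j *v ?e a)) = trace (S i ** S j)"
        by (simp only: trace_scalar_product symmetric[OF i])
      have "scalar_product (S i *v (S j *v ?e a)) w * f i (?e a) =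
          scalar_product (S j *v (S i *v w)) (?e a) * scalar_product (form_vec i) (?e a)" for a
        using i j by (simp add: self_adjoint form_vec scalar_product_commute[of _ "?e a"])
      then have 2: "(\<Sum>a\<in>UNIV. scalar_product (S i *v (S j *v ?e a)) w * f i (?e a)) =
          scalar_product (S i *v (S j *v form_vec i)) w"
        using i j by (simp only: scalar_product_parseval)
          (simp add: self_adjoint scalar_product_commute[of _ "form_vec i"])
      have "scalar_product (S i *v w) (?e a) * f i (S j *v ?e a) =
          scalar_product (S i *v w) (?e a) * scalar_product (S j *v form_vec i) (?e a)" for a
        using i j by (simp add: self_adjoint form_vec)
      then have 3: "(\<Sum>a\<in>UNIV. scalar_product (S i *v w) (?e a) * f i (S j *v ?e a)) =
          scalar_product (S i *v (S j *v form_vec i)) w"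
        using i j by (simp only: scalar_product_parseval)
          (simp add: self_adjoint scalar_product_commute[of w])
      show "(\<Sum>a\<in>UNIV. scalar_product (S i *v ?e a) (S j *v ?e a) * f i w
      + scalar_product (S i *v (S j *v ?e a)) w * f i (?e a)
      + scalar_product (S i *v w) (?e a) * f i (S j *v ?e a)) =
        trace (S i ** S j) * scalar_product (form_vec i) w + 2 * scalar_product (S i *v (S j *v form_vec i)) w"
        unfolding sum.distrib 2 3 sum_distrib_right[symmetric] 1 by (simp add: form_vec[OF i])
    qed
    also have "\<dots> = scalar_product w (\<Sum>i\<in>{1..p+q}. trace (S i ** S j) *s form_vec i + 2 *s (S i *v (S j *v form_vec i)))"
      by (simp add: scalar_product_sum scalar_product_add scalar_product_scale scalar_product_commute[of w])
    finally show ?thesis by (simp add: scalar_product_commute)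
  qed
  from this[of "axis _ 1"] show ?thesis
    by (simp add: scalar_product_commute[of _ "axis _ 1"] scalar_product_axis vec_eq_iff)
qed

lemma dimension_if_cubic_relation:
  assumes "q \<le> p" "(p, q) \<noteq> (1, 1)" and nz: "\<exists>i\<in>{1..p+q}. \<exists>w. f i w \<noteq> 0"
  shows "CARD('m) + 4 = 2 * (p + q)"
proof -
  define b where "b i = S i *v form_vec i" for i
  define B where "B = (\<Sum>i\<in>{1..p+q}. \<epsilon> i *s b i)"
  let ?m = "real CARD('m)"
  have b: "(?m + 4) *s b j = (2 * \<epsilon> j) *s B" if j: "j \<in> {1..p+q}" for j
  proof -
    have "0 = S j *v (\<Sum>i\<in>{1..p+q}. trace (S i ** S j) *s form_vec i + 2 *s (S i *v (S j *v form_vec i)))"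
      by (simp only: cubic_contracted[OF j] vec.zero)
    \<comment> \<open>For i = j the coefficient of \<open>b j\<close> is m + 2. Writing it as (m +
      4) - 2 lets the remaining sum run over all i, so that it becomes \<open>B\<close>.\<close>
    also have "\<dots> = (\<Sum>i\<in>{1..p+q}. (if i = j then (?m + 4) *s b j else 0) - (2 * \<epsilon> j) *s (\<epsilon> i *s b i))"
      unfolding vec.sum
    proof (rule sum.cong[OF refl])
      fix i assume i: "i \<in> {1..p+q}"
      show "S j *v (trace (S i ** S j) *s form_vec i + 2 *s (S i *v (S j *v form_vec i))) =
        (if i = j then (?m + 4) *s b j else 0) - (2 * \<epsilon> j) *s (\<epsilon> i *s b i)"
      proof (cases "i = j")
        case True
        then show ?thesis using j
          by (simp add: b_def vec.add vec.scale square_vec trace_square vec_eq_iff algebra_simps)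
      next
        case False
        then show ?thesis
          using i j trace_mult_eq_0[OF assms(1,2) i j False] swap_vec[OF i j False, of "form_vec i"]
          by (simp add: b_def vec.add vec.scale vec.neg square_vec mult_ac)
      qed
    qed
    also have "\<dots> = (?m + 4) *s b j - (2 * \<epsilon> j) *s B"
      using j by (simp add: sum_subtractf B_def vec.scale_sum_right)
    finally show ?thesis by simp
  qed
  \<comment> \<open>Summing the equations for \<open>b j\<close> with weights
    \<open>\<epsilon> j\<close> leaves an equation in \<open>B\<close> alone. It fixes m because
    \<open>B = 0\<close> would force all the linear forms to vanish.\<close>
  have "(?m + 4) *s B = (\<Sum>j\<in>{1..p+q}. \<epsilon> j *s ((?m + 4) *s b j))"
    by (simp only: B_def vec.scale_sum_right vector_smult_assoc mult.commute)
  also have "\<dots> = (\<Sum>j\<in>{1..p+q}. 2 *s B)"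
    by (rule sum.cong) (simp_all only: b vector_smult_assoc mult.left_commute[of "\<epsilon> _" 2] sig_sign_mult mult_1_right)
  also have "\<dots> = (2 * real (p + q)) *s B"
    by (simp only: sum_constant_scaleR scalar_mult_eq_scaleR) simp
  finally have eq: "(?m + 4) *s B = (2 * real (p + q)) *s B" .
  have "B \<noteq> 0"
  proof
    assume B: "B = 0"
    have "f i w = 0" if i: "i \<in> {1..p+q}" for i w
    proof -
      have "(?m + 4) *s b i = 0" using b[OF i] B by simp
      then have "b i = 0"
        unfolding vec.scale_eq_0_iff by linarith
      then have "form_vec i = 0"
        using square_vec[OF i, of "form_vec i"] by (simp add: b_def)
      then show ?thesis by (simp add: form_vec[OF i] scalar_product_def)
    qed
    then show False using nz by auto
  qed
  then obtain a where "B $ a \<noteq> 0" by (auto simp: vec_eq_iff)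
  moreover have "(?m + 4) * B $ a = (2 * real (p + q)) * B $ a"
    using eq by (metis vector_smult_component)
  ultimately have "?m + 4 = 2 * real (p + q)" by simp
  then show ?thesis by linarith
qed

text \<open>The contracted relations decouple for the sum c and the difference d of the two form
  vectors. As \<open>S 1 ** S 2\<close> is an isometry, norms give (m + t) |c| = 0 and (m - t) |d| =
  0. So t is m or -m, the equality case of Cauchy-Schwarz for the matrices \<open>S 1\<close> and
  \<open>S 2\<close>.\<close>

lemma equal_if_cubic_relation:
  assumes pq: "p = 1" "q = 1" and nz: "\<exists>i\<in>{1..p+q}. \<exists>w. f i w \<noteq> 0"
  shows "S 1 = S 2 \<or> S 1 = - S 2"
proof -
  note One_nat_def [simp del]
  let ?m = "real CARD('m)"
  define t where "t = trace (S 1 ** S 2)"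
  have I: "{1..p+q} = {1, 2}" using pq by auto
  have com: "S 2 ** S 1 = S 1 ** S 2" using pq by (intro commute) auto
  have tr: "trace (S 1 ** S 1) = ?m" "trace (S 2 ** S 2) = ?m"
    using pq trace_square[of 1] trace_square[of 2] by simp_all
  have sq: "S 1 *v (S 1 *v v) = v" "S 2 *v (S 2 *v v) = v" for v
    using pq by (simp_all add: square_vec)
  have com_vec: "S 2 *v (S 1 *v v) = S 1 *v (S 2 *v v)" for v
    by (simp only: matrix_vector_mul_assoc com)
  have eq1: "(?m + 2) *s form_vec 1 + t *s form_vec 2 + 2 *s (S 1 *v (S 2 *v form_vec 2)) = 0"
    using cubic_contracted[of 1] pq unfolding I
    by (simp add: tr com sq com_vec t_def[symmetric] algebra_simps vector_sadd_rdistrib)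
  have eq2: "(?m + 2) *s form_vec 2 + t *s form_vec 1 + 2 *s (S 1 *v (S 2 *v form_vec 1)) = 0"
    using cubic_contracted[of 2] pq unfolding I
    by (simp add: tr com sq com_vec t_def[symmetric] algebra_simps vector_sadd_rdistrib)
  have norm: "norm (S 1 *v (S 2 *v v)) = norm v" for v
    using isometry[of 1 "S 2 *v v" "S 2 *v v"] isometry[of 2 v v] pq
    by (simp add: norm_eq_sqrt_inner inner_vec_def scalar_product_def)
  \<comment> \<open>The squared Frobenius norm of \<open>S 1\<close> plus or minus
    \<open>S 2\<close>. Being nonnegative it bounds t by m in absolute value, and where it vanishes
    the matrices agree up to sign.\<close>
  have frob: "(\<Sum>a\<in>UNIV. \<Sum>b\<in>UNIV. (S 1 $ a $ b + s * S 2 $ a $ b)\<^sup>2) = 2 * (?m + s * t)" if "s\<^sup>2 = 1" for s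
  proof -
    have e: "(\<Sum>a\<in>UNIV. \<Sum>b\<in>UNIV. S i $ a $ b * S j $ a $ b) = trace (S i ** S j)" if "i \<in> {1,2}" "j \<in> {1,2}" for i j
      using that(2) trace_mult_eq_sum[of j i] unfolding I by simp
    have "(\<Sum>a\<in>UNIV. \<Sum>b\<in>UNIV. (S 1 $ a $ b + s * S 2 $ a $ b)\<^sup>2) =
      (\<Sum>a\<in>UNIV. \<Sum>b\<in>UNIV. S 1 $ a $ b * S 1 $ a $ b + (s\<^sup>2 * (S 2 $ a $ b * S 2 $ a $ b)
        + 2 * s * (S 1 $ a $ b * S 2 $ a $ b)))"
      by (intro sum.cong refl) (simp add: power2_eq_square algebra_simps)
    also have "\<dots> = ?m + (s\<^sup>2 * ?m + 2 * s * t)"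
      unfolding sum.distrib sum_distrib_left[symmetric] by (simp add: e tr t_def)
    finally show ?thesis using that by (simp add: algebra_simps)
  qed
  have "0 \<le> 2 * (?m + s * t)" if "s\<^sup>2 = 1" for s
    unfolding frob[OF that, symmetric] by (intro sum_nonneg) simp
  from this[of 1] this[of "-1"] have pos: "0 \<le> ?m + t" "0 \<le> ?m - t" by simp_all
  define c d where "c = form_vec 1 + form_vec 2" and "d = form_vec 1 - form_vec 2"
  have "(?m + 2 + t) *s c = (-2) *s (S 1 *v (S 2 *v c))" "(?m + 2 - t) *s d = 2 *s (S 1 *v (S 2 *v d))"
  proof -
    have "(?m + 2 + t) *s c + 2 *s (S 1 *v (S 2 *v c)) =
      ((?m + 2) *s form_vec 1 + t *s form_vec 2 + 2 *s (S 1 *v (S 2 *v form_vec 2))) +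
      ((?m + 2) *s form_vec 2 + t *s form_vec 1 + 2 *s (S 1 *v (S 2 *v form_vec 1)))"
      unfolding c_def by (simp add: vec.add vec_eq_iff algebra_simps)
    then show "(?m + 2 + t) *s c = (-2) *s (S 1 *v (S 2 *v c))"
      unfolding eq1 eq2 by (simp add: eq_neg_iff_add_eq_0)
    have "(?m + 2 - t) *s d - 2 *s (S 1 *v (S 2 *v d)) =
      ((?m + 2) *s form_vec 1 + t *s form_vec 2 + 2 *s (S 1 *v (S 2 *v form_vec 2))) -
      ((?m + 2) *s form_vec 2 + t *s form_vec 1 + 2 *s (S 1 *v (S 2 *v form_vec 1)))"
      unfolding d_def by (simp add: vec.diff vec_eq_iff algebra_simps)
    then show "(?m + 2 - t) *s d = 2 *s (S 1 *v (S 2 *v d))"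
      unfolding eq1 eq2 by simp
  qed
  then have "\<bar>?m + 2 + t\<bar> * norm c = 2 * norm c" "\<bar>?m + 2 - t\<bar> * norm d = 2 * norm d"
    unfolding scalar_mult_eq_scaleR by (metis norm norm_scaleR abs_minus_cancel abs_numeral)+
  then have "(?m + t) * norm c = 0" "(?m - t) * norm d = 0"
    using pos by (auto simp: abs_of_nonneg)
  moreover have "c \<noteq> 0 \<or> d \<noteq> 0"
  proof (rule ccontr)
    assume "\<not> (c \<noteq> 0 \<or> d \<noteq> 0)"
    then have "form_vec 1 = 0" "form_vec 2 = 0"
      unfolding c_def d_def by (auto simp: vec_eq_iff)
    then have "f i w = 0" if "i \<in> {1..p+q}" for i w
      using that form_vec[OF that] unfolding I by (auto simp: scalar_product_def)
    then show False using nz by auto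
  qed
  ultimately have "?m + 1 * t = 0 \<or> ?m + (-1) * t = 0" by auto
  moreover have "S 1 $ a $ b + s * S 2 $ a $ b = 0" if "s\<^sup>2 = 1" "?m + s * t = 0" for s a b
    using frob[OF that(1)] that(2) by (simp add: sum_nonneg_eq_0_iff sum_nonneg)
  note this[of 1] this[of "- 1"]
  ultimately have "(\<forall>a b. S 1 $ a $ b + 1 * S 2 $ a $ b = 0) \<or> (\<forall>a b. S 1 $ a $ b + (- 1) * S 2 $ a $ b = 0)"
    by auto
  then show ?thesis by (auto simp: vec_eq_iff eq_neg_iff_add_eq_0)
qed

end

section \<open>The equivalence\<close>

lemma four_mult_less_power2: "5 \<le> k \<Longrightarrow> 4 * k < 2 ^ k" for k :: nat
  by (induction k rule: nat_induct_at_least) auto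

text \<open>For q = 1 the dimension is 2 * p - 2. The power of 2 exceeds it once p div 2 is at least
  5, so only p from 2 to 9 has to be inspected.\<close>

lemma power2_dvd_one_factor:
  assumes "2 \<le> p" "2 ^ (p div 2) dvd 2 * p - 2"
  shows "p \<in> {2, 3, 5, 9 :: nat}"
proof -
  have "2 ^ (p div 2) \<le> 2 * p - 2"
    using assms by (intro dvd_imp_le) auto
  moreover have "2 * p - 2 \<le> 4 * (p div 2)" by linarith
  ultimately have "p div 2 < 5"
    using four_mult_less_power2[of "p div 2"] by linarith
  then have "p \<in> {2..9}" using assms(1) by simp
  then have "p \<in> {2, 3, 4, 5, 6, 7, 8, 9}" by auto
  then show ?thesis using assms(2) by auto
qed

text \<open>The case q = p, where the dimension is 4 * p - 4 and the growth of the power leaves only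
  p \<le> 5.\<close>

lemma power2_dvd_two_factors:
  assumes "2 \<le> p" "2 ^ (p div 2 + p div 2) dvd 4 * p - 4"
  shows "p \<in> {2, 3, 5 :: nat}"
proof -
  let ?k = "p div 2"
  have "2 ^ (?k + ?k) \<le> 4 * p - 4"
    using assms by (intro dvd_imp_le) auto
  moreover have "4 * p - 4 \<le> 4 * (?k + ?k)" by presburger
  ultimately have "?k + ?k < 5"
    using four_mult_less_power2[of "?k + ?k"] by linarith
  then have "p \<in> {2, 3, 4, 5}" using assms(1) by auto
  then show ?thesis using assms(2) by auto
qed

lemma dimension_cases:
  fixes S :: "nat \<Rightarrow> real^'m^'m"
  assumes S: "clifford_system p q S" and "q \<le> p" "1 \<le> p + q" and ne: "(p, q) \<noteq> (1, 1)"
    and m: "CARD('m) + 4 = 2 * (p + q)"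
  shows "(p, q, CARD('m)) \<in> {(2,1,2), (3,1,4), (5,1,8), (9,1,16), (2,2,4), (3,3,8), (5,5,16)}"
proof -
  interpret clifford_system p q S by fact
  have dvd: "2 ^ (p div 2 + q div 2) dvd CARD('m)"
    by (rule clifford_system_dvd_complex[OF clifford_system_complexify[OF S]])
  \<comment> \<open>Otherwise q = 0 and the dimension plus 4 would be at most 2.\<close>
  have "2 \<le> p" using m assms(2) ne by (cases "p = 1") (auto simp: not_le)
  show ?thesis
  proof (cases "q = 1")
    case True
    then have card: "CARD('m) = 2 * p - 2" using m by simp
    then have "p \<in> {2, 3, 5, 9}"
      using power2_dvd_one_factor[OF \<open>2 \<le> p\<close>] dvd True by simp
    then have "p = 2 \<or> p = 3 \<or> p = 5 \<or> p = 9" by simp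
    then show ?thesis by (elim disjE) (use card True in simp_all)
  next
    case False
    \<comment> \<open>The dimension equation already makes the quartic vanish, which opens the way
      to the Hessian trace.\<close>
    have "p = q"
      using quartic_zero_if_dimension[OF S assms(2) ne m] \<open>2 \<le> p\<close> False by (rule quartic_zero_imp_eq)
    have card: "CARD('m) = 4 * p - 4" using m unfolding \<open>p = q\<close> by simp
    have "p \<in> {2, 3, 5}"
      using dvd unfolding card \<open>p = q\<close>[symmetric] by (rule power2_dvd_two_factors[OF \<open>2 \<le> p\<close>])
    then have "p = 2 \<or> p = 3 \<or> p = 5" by simp
    then show ?thesis by (elim disjE) (use card \<open>p = q\<close>[symmetric] in simp_all)
  qed
qed

text \<open>The derivative of the vanishing quartic in a fixed direction h is a relation whose
  linear forms are \<open>f i\<close>, up to a constant factor.\<close>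

lemma cubic_relation_if_quartic_zero:
  fixes S :: "nat \<Rightarrow> real^'m^'m"
  assumes "clifford_system p q S" "1 \<le> p + q" and zero: "\<forall>w. clifford_quartic p q S w = 0"
  shows "\<exists>f :: nat \<Rightarrow> real^'m \<Rightarrow> real. (\<forall>i\<in>{1..p+q}. linear (f i)) \<and>
    (\<exists>i\<in>{1..p+q}. \<exists>w. f i w \<noteq> 0) \<and> (\<forall>w. (\<Sum>i\<in>{1..p+q}. quad_val (S i) w * f i w) = 0)"
proof -
  interpret clifford_system p q S by fact
  define h :: "real^'m" where "h = axis undefined 1"
  define f where "f i w = sig_sign p i * scalar_product (S i *v w) h" for i w
  have "linear (f i)" for i
    unfolding f_def
    by (rule linearI) (simp_all add: vec.add scalar_product_add_left distrib_left vec.scale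
        scalar_product_scale mult_ac flip: scalar_mult_eq_scaleR)
  \<comment> \<open>Since \<open>S 1\<close> is an involution, this value is the squared length of h
    up to sign.\<close>
  moreover have "f 1 (S 1 *v h) \<noteq> 0"
    using assms(2) by (simp add: f_def square_vec sig_sign_def) (simp add: h_def scalar_product_axis)
  moreover have "(\<Sum>i\<in>{1..p+q}. quad_val (S i) w * f i w) = 0" for w
    using quartic_zero_gradient[of w h] zero by (simp add: f_def mult_ac)
  ultimately show ?thesis
    using assms(2) by (intro exI[of _ f]) force
qed

theorem theorem2p7:
  fixes p q :: nat
    and \<rho> :: "(nat set \<times> nat set \<Rightarrow> real) \<Rightarrow> real^'m^'m"
    and S :: "nat \<Rightarrow> real^'m^'m"
  assumes "q \<le> p" and "1 \<le> p + q"
    and "representation p q \<rho>"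
    and "S = basis_matrices p q \<rho>"
    and "\<And>i. i \<in> {1..p+q} \<Longrightarrow> transpose (S i) = S i"
  shows "(degenerate p q S \<longleftrightarrow> (\<forall>w. clifford_quartic p q S w = 0))
    \<and> ((\<forall>w. clifford_quartic p q S w = 0) \<longleftrightarrow>
        (\<exists>f :: nat \<Rightarrow> real^'m \<Rightarrow> real.
            (\<forall>i\<in>{1..p+q}. linear (f i)) \<and>
            (\<exists>i\<in>{1..p+q}. \<exists>w. f i w \<noteq> 0) \<and>
            (\<forall>w. (\<Sum>i\<in>{1..p+q}. quad_val (S i) w * f i w) = 0)))
    \<and> ((\<exists>f :: nat \<Rightarrow> real^'m \<Rightarrow> real.
            (\<forall>i\<in>{1..p+q}. linear (f i)) \<and>
            (\<exists>i\<in>{1..p+q}. \<exists>w. f i w \<noteq> 0) \<and>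
            (\<forall>w. (\<Sum>i\<in>{1..p+q}. quad_val (S i) w * f i w) = 0)) \<longleftrightarrow>
        ((p, q, CARD('m)) \<in> {(2,1,2), (3,1,4), (5,1,8), (9,1,16), (2,2,4), (3,3,8), (5,5,16)}
          \<or> (p = 1 \<and> q = 1 \<and> (S 1 = S 2 \<or> S 1 = - S 2))))"
    (is "(?i \<longleftrightarrow> ?ii) \<and> (?ii \<longleftrightarrow> ?iii) \<and> (?iii \<longleftrightarrow> ?iv)")
proof -
  have S: "clifford_system p q S"
    unfolding assms(4) using assms(3,5) unfolding assms(4) by (rule clifford_system_basis_matrices)
  have 1: "?i \<longleftrightarrow> ?ii"
    using nondegenerateI[OF S] quartic_zero_imp_degenerate[OF S] by blast
  have 2: "?ii \<Longrightarrow> ?iii"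
    using S assms(2) by (rule cubic_relation_if_quartic_zero)
  have 3: "?iii \<Longrightarrow> ?iv"
  proof -
    assume ?iii
    then obtain f :: "nat \<Rightarrow> real^'m \<Rightarrow> real" where f: "\<And>i. i \<in> {1..p+q} \<Longrightarrow> linear (f i)"
      "\<And>w. (\<Sum>i\<in>{1..p+q}. quad_val (S i) w * f i w) = 0" "\<exists>i\<in>{1..p+q}. \<exists>w. f i w \<noteq> 0"
      by blast
    show ?iv
    proof (cases "(p, q) = (1, 1)")
      case True
      then show ?thesis using equal_if_cubic_relation[OF S f(1,2) _ _ f(3)] by simp
    next
      case False
      have "CARD('m) + 4 = 2 * (p + q)"
        using S f(1,2) assms(1) False f(3) by (rule dimension_if_cubic_relation)
      then show ?thesis
        by (intro disjI1 dimension_cases[OF S assms(1,2) False])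
    qed
  qed
  have 4: "?iv \<Longrightarrow> ?ii"
  proof -
    assume iv: ?iv
    show ?ii
    proof (cases "(p, q) = (1, 1)")
      case True
      then have "S 1 = S 2 \<or> S 1 = - S 2" using iv by auto
      then have "(quad_val (S 1) w)\<^sup>2 = (quad_val (S 2) w)\<^sup>2" for w
        by (auto simp: quad_val_scalar_product matrix_vector_mult_uminus scalar_product_uminus)
      then show ?thesis using True
        by (simp add: clifford_quartic_def sig_form_def quad_map_def eval_nat_numeral)
    next
      case False
      then have "CARD('m) + 4 = 2 * (p + q)" using iv by auto
      then show ?thesis
        using quartic_zero_if_dimension[OF S assms(1) False] by blast
    qed
  qed
  have cycle: "(A \<longleftrightarrow> B) \<and> (B \<longleftrightarrow> C) \<and> (C \<longleftrightarrow> D)"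
    if "A \<longleftrightarrow> B" "B \<Longrightarrow> C" "C \<Longrightarrow> D" "D \<Longrightarrow> B" for A B C D
    using that by blast
  show ?thesis by (rule cycle[OF 1 2 3 4])
qed

end
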